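(* Let $\Sigma$ be a set of group equations. (a) For any set $X$ such that $F_\Sigma(X)$ is fully bi-orderable and any elements $[t_1],\dots,[t_n]$ in $F_\Sigma(X)$ ($n\ge1$) corresponding to $t_1,\dots,t_n\in F(X)$, $$e\in\{[t_1],\dots,[t_n]\}^\circ\iff\mathsf{Rep}_\Sigma\models e\le t_1\vee\cdots\vee t_n,$$ where on the left $e$ denotes the identity of $F_\Sigma(X)$. (b) If $F_\Sigma(\omega)$ is fully bi-orderable, then the Normal Identity Problem for $F_\Sigma(\omega)$ is decidable if and only if $\mathsf{Rep}_\Sigma$ has a decidable equational theory.
   Context: $F(X)$ is the free group over $X$, and $F_\Sigma(X)$ is the relatively free group over $X$ of the variety of groups satisfying $\Sigma$; $F_\Sigma(\omega)$ is the case of a countably infinite set of generators. The element of $F_\Sigma(X)$ represented by $t\in F(X)$ is denoted $[t]$. A partial bi-order on a group $G$ is a partial order $\le$ with $a\le b\Rightarrow cad\le cbd$ for all $a,b,c,d\in G$; it is a bi-order if total. $G$ is fully bi-orderable if every partial bi-order on $G$ extends to a bi-order on $G$ (i.e. its positive cone $\{a\mid e<a\}$ is contained in that of a bi-order). For $S\subseteq G$, $S^\circ$ is the normal subsemigroup generated by $S$, i.e. the smallest subsemigroup containing $S$ and closed under conjugation by elements of $G$. The Normal Identity Problem for $G$ asks, for a given finite $S\subseteq G$ (elements given as group words in the generators), whether the identity lies in $S^\circ$. An $\ell$-group is a structure $\langle L,\wedge,\vee,\cdot,{}^{-1},e\rangle$ such that $\langle L,\cdot,{}^{-1},e\rangle$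 is a group, $\langle L,\wedge,\vee\rangle$ is a lattice with order $a\le b:\Leftrightarrow a\wedge b=a$, and $a\le b$ implies $cad\le cbd$. An $\ell$-group is representable if it is a subdirect product of totally ordered $\ell$-groups; these form a variety, axiomatized relative to $\ell$-groups by $e\le x\vee yx^{-1}y^{-1}$. $\mathsf{Rep}_\Sigma$ is the variety of representable $\ell$-groups satisfying $\Sigma$. $\mathsf{Rep}_\Sigma\models s\le t$ means that $s\wedge t\approx s$ holds in all members of $\mathsf{Rep}_\Sigma$ under all assignments of the variables. The equational theory is decidable if there is an algorithm deciding, for each $\ell$-group equation, whether it holds in all members of $\mathsf{Rep}_\Sigma$. *)

theory Defs
  imports
    "HOL-Algebra.Product_Groups"
    "HOL-Algebra.Generated_Groups"
    "HOL-Library.Nat_Bijection"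
    "HOL-Library.Countable_Set"
begin

section \<open>Group terms and group equations\<close>

datatype 'v gterm = GVar 'v | GOne | GInv "'v gterm" | GMult "'v gterm" "'v gterm"

type_synonym group_eqs = "(nat gterm \<times> nat gterm) set"

primrec geval :: "('a, 'm) monoid_scheme \<Rightarrow> ('v \<Rightarrow> 'a) \<Rightarrow> 'v gterm \<Rightarrow> 'a" where
  "geval G a (GVar v) = a v"
| "geval G a GOne = \<one>\<^bsub>G\<^esub>"
| "geval G a (GInv t) = inv\<^bsub>G\<^esub> (geval G a t)"
| "geval G a (GMult s t) = geval G a s \<otimes>\<^bsub>G\<^esub> geval G a t"

definition satisfies :: "('a, 'm) monoid_scheme \<Rightarrow> group_eqs \<Rightarrow> bool" where
  "satisfies G \<Sigma> \<longleftrightarrow> (\<forall>(s, t) \<in> \<Sigma>. \<forall>a \<in> UNIV \<rightarrow> carrier G. geval G a s = geval G a t)"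


section \<open>Free and relatively free groups\<close>

text \<open>A group word is a list of letters; \<open>(x, True)\<close> is the generator \<open>x\<close> and
  \<open>(x, False)\<close> its inverse.  The elements of \<open>F(X)\<close> are the reduced words over \<open>X\<close>.\<close>

type_synonym 'x word = "('x \<times> bool) list"

definition opp :: "'x \<times> bool \<Rightarrow> 'x \<times> bool" where
  "opp l = (fst l, \<not> snd l)"

definition reduced :: "'x word \<Rightarrow> bool" where
  "reduced w \<longleftrightarrow> successively (\<lambda>l l'. l' \<noteq> opp l) w"

fun push :: "'x \<times> bool \<Rightarrow> 'x word \<Rightarrow> 'x word" where
  "push l [] = [l]"
| "push l (l' # w) = (if l' = opp l then w else l # l' # w)"

definition reduce :: "'x word \<Rightarrow> 'x word" where
  "reduce w = foldr push w []"

definition free_group :: "'x set \<Rightarrow> 'x word monoid" where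
  "free_group X =
    \<lparr> carrier = {w. reduced w \<and> fst ` set w \<subseteq> X}, mult = (\<lambda>u v. reduce (u @ v)), one = [] \<rparr>"

text \<open>\<open>F\<^sub>\<Sigma>(X)\<close> is the quotient of \<open>F(X)\<close> by the verbal subgroup of \<open>\<Sigma>\<close>, generated by
  all instances in \<open>F(X)\<close> of the equations of \<open>\<Sigma>\<close>.  Theorems \<open>rel_free_group_satisfies\<close>,
  \<open>rel_free_group_universal\<close> and \<open>rel_free_group_hom_unique\<close> below show that it is relatively
  free over \<open>X\<close>.\<close>

definition verbal :: "group_eqs \<Rightarrow> 'x set \<Rightarrow> 'x word set" where
  "verbal \<Sigma> X = generate (free_group X)
     {geval (free_group X) a s \<otimes>\<^bsub>free_group X\<^esub> inv\<^bsub>free_group X\<^esub> (geval (free_group X) a t) | s t a.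
        (s, t) \<in> \<Sigma> \<and> a \<in> UNIV \<rightarrow> carrier (free_group X)}"

definition rel_free_group :: "group_eqs \<Rightarrow> 'x set \<Rightarrow> 'x word set monoid" where
  "rel_free_group \<Sigma> X = free_group X Mod verbal \<Sigma> X"

definition rel_class :: "group_eqs \<Rightarrow> 'x set \<Rightarrow> 'x word \<Rightarrow> 'x word set" where
  "rel_class \<Sigma> X w = verbal \<Sigma> X #>\<^bsub>free_group X\<^esub> w"


section \<open>Bi-orders and normal subsemigroups\<close>

definition partial_bi_order :: "('a, 'm) monoid_scheme \<Rightarrow> 'a rel \<Rightarrow> bool" where
  "partial_bi_order G r \<longleftrightarrow> partial_order_on (carrier G) r \<and>
     (\<forall>a \<in> carrier G. \<forall>b \<in> carrier G. \<forall>c \<in> carrier G. \<forall>d \<in> carrier G.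
        (a, b) \<in> r \<longrightarrow> (c \<otimes>\<^bsub>G\<^esub> a \<otimes>\<^bsub>G\<^esub> d, c \<otimes>\<^bsub>G\<^esub> b \<otimes>\<^bsub>G\<^esub> d) \<in> r)"

definition bi_order :: "('a, 'm) monoid_scheme \<Rightarrow> 'a rel \<Rightarrow> bool" where
  "bi_order G r \<longleftrightarrow> partial_bi_order G r \<and> total_on (carrier G) r"

definition fully_bi_orderable :: "('a, 'm) monoid_scheme \<Rightarrow> bool" where
  "fully_bi_orderable G \<longleftrightarrow> (\<forall>r. partial_bi_order G r \<longrightarrow> (\<exists>r'. bi_order G r' \<and> r \<subseteq> r'))"

inductive_set normal_subsemigroup :: "('a, 'm) monoid_scheme \<Rightarrow> 'a set \<Rightarrow> 'a set"
  for G and S where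
  base: "s \<in> S \<Longrightarrow> s \<in> normal_subsemigroup G S"
| mult: "\<lbrakk>a \<in> normal_subsemigroup G S; b \<in> normal_subsemigroup G S\<rbrakk>
    \<Longrightarrow> a \<otimes>\<^bsub>G\<^esub> b \<in> normal_subsemigroup G S"
| conj: "\<lbrakk>a \<in> normal_subsemigroup G S; g \<in> carrier G\<rbrakk>
    \<Longrightarrow> g \<otimes>\<^bsub>G\<^esub> a \<otimes>\<^bsub>G\<^esub> inv\<^bsub>G\<^esub> g \<in> normal_subsemigroup G S"


section \<open>Lattice-ordered groups\<close>

record 'a lgrp = "'a monoid" +
  lmeet :: "'a \<Rightarrow> 'a \<Rightarrow> 'a"
  ljoin :: "'a \<Rightarrow> 'a \<Rightarrow> 'a"

definition lle :: "('a, 'm) lgrp_scheme \<Rightarrow> 'a \<Rightarrow> 'a \<Rightarrow> bool" where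
  "lle L x y \<longleftrightarrow> lmeet L x y = x"

locale l_group = group L for L :: "('a, 'm) lgrp_scheme" (structure) +
  assumes meet_closed: "\<lbrakk>x \<in> carrier L; y \<in> carrier L\<rbrakk> \<Longrightarrow> lmeet L x y \<in> carrier L"
    and join_closed: "\<lbrakk>x \<in> carrier L; y \<in> carrier L\<rbrakk> \<Longrightarrow> ljoin L x y \<in> carrier L"
    and meet_commute: "\<lbrakk>x \<in> carrier L; y \<in> carrier L\<rbrakk> \<Longrightarrow> lmeet L x y = lmeet L y x"
    and join_commute: "\<lbrakk>x \<in> carrier L; y \<in> carrier L\<rbrakk> \<Longrightarrow> ljoin L x y = ljoin L y x"
    and meet_assoc: "\<lbrakk>x \<in> carrier L; y \<in> carrier L; z \<in> carrier L\<rbrakk>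
      \<Longrightarrow> lmeet L (lmeet L x y) z = lmeet L x (lmeet L y z)"
    and join_assoc: "\<lbrakk>x \<in> carrier L; y \<in> carrier L; z \<in> carrier L\<rbrakk>
      \<Longrightarrow> ljoin L (ljoin L x y) z = ljoin L x (ljoin L y z)"
    and meet_join_absorb: "\<lbrakk>x \<in> carrier L; y \<in> carrier L\<rbrakk> \<Longrightarrow> lmeet L x (ljoin L x y) = x"
    and join_meet_absorb: "\<lbrakk>x \<in> carrier L; y \<in> carrier L\<rbrakk> \<Longrightarrow> ljoin L x (lmeet L x y) = x"
    and translate: "\<lbrakk>a \<in> carrier L; b \<in> carrier L; c \<in> carrier L; d \<in> carrier L; lle L a b\<rbrakk>
      \<Longrightarrow> lle L (c \<otimes> a \<otimes> d) (c \<otimes> b \<otimes> d)"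

locale ordered_l_group = l_group +
  assumes total: "\<lbrakk>x \<in> carrier L; y \<in> carrier L\<rbrakk> \<Longrightarrow> lle L x y \<or> lle L y x"

definition lhom :: "('a, 'm) lgrp_scheme \<Rightarrow> ('b, 'n) lgrp_scheme \<Rightarrow> ('a \<Rightarrow> 'b) set" where
  "lhom L M = {h \<in> hom L M. \<forall>x \<in> carrier L. \<forall>y \<in> carrier L.
     h (lmeet L x y) = lmeet M (h x) (h y) \<and> h (ljoin L x y) = ljoin M (h x) (h y)}"

definition product_lgrp :: "'i set \<Rightarrow> ('i \<Rightarrow> ('a, 'm) lgrp_scheme) \<Rightarrow> ('i \<Rightarrow> 'a) lgrp" where
  "product_lgrp I M = monoid.extend (product_group I M)
     \<lparr> lmeet = (\<lambda>x y. \<lambda>i\<in>I. lmeet (M i) (x i) (y i)),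
       ljoin = (\<lambda>x y. \<lambda>i\<in>I. ljoin (M i) (x i) (y i)) \<rparr>"

definition subdirect_embedding ::
  "('a, 'm) lgrp_scheme \<Rightarrow> 'i set \<Rightarrow> ('i \<Rightarrow> ('b, 'n) lgrp_scheme) \<Rightarrow> ('a \<Rightarrow> 'i \<Rightarrow> 'b) \<Rightarrow> bool" where
  "subdirect_embedding L I M \<phi> \<longleftrightarrow> \<phi> \<in> lhom L (product_lgrp I M) \<and> inj_on \<phi> (carrier L) \<and>
     (\<forall>i \<in> I. (\<lambda>x. \<phi> x i) ` carrier L = carrier (M i))"

text \<open>Taking the index set and the factors inside the type of \<open>L\<close> itself is no restriction: every
  factor is a homomorphic image of \<open>L\<close>, and one factor separating \<open>x\<close> from the identity for each
  \<open>x\<close> in \<open>L\<close> suffices.  This is theorem \<open>representable_if_subdirect\<close> below.\<close>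

definition representable :: "'a lgrp \<Rightarrow> bool" where
  "representable L \<longleftrightarrow> l_group L \<and>
     (\<exists>(I :: 'a set) (M :: 'a \<Rightarrow> 'a lgrp) \<phi>.
        (\<forall>i \<in> I. ordered_l_group (M i)) \<and> subdirect_embedding L I M \<phi>)"


section \<open>Equations in representable \<open>\<ell>\<close>-groups\<close>

datatype 'v lterm = LVar 'v | LOne | LInv "'v lterm" | LMult "'v lterm" "'v lterm"
  | LMeet "'v lterm" "'v lterm" | LJoin "'v lterm" "'v lterm"

primrec leval :: "('a, 'm) lgrp_scheme \<Rightarrow> ('v \<Rightarrow> 'a) \<Rightarrow> 'v lterm \<Rightarrow> 'a" where
  "leval L a (LVar v) = a v"
| "leval L a LOne = \<one>\<^bsub>L\<^esub>"
| "leval L a (LInv t) = inv\<^bsub>L\<^esub> (leval L a t)"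
| "leval L a (LMult s t) = leval L a s \<otimes>\<^bsub>L\<^esub> leval L a t"
| "leval L a (LMeet s t) = lmeet L (leval L a s) (leval L a t)"
| "leval L a (LJoin s t) = ljoin L (leval L a s) (leval L a t)"

definition Rep :: "group_eqs \<Rightarrow> 'a lgrp set" where
  "Rep \<Sigma> = {L. representable L \<and> satisfies L \<Sigma>}"

text \<open>Validity in the members of \<open>Rep \<Sigma>\<close> whose carrier lies in the type \<open>'l\<close>.  For infinite \<open>'l\<close>
  this is validity in all members of \<open>Rep \<Sigma>\<close>, whatever their carrier type: see theorem
  \<open>Rep_eq_all_types\<close> below.\<close>

definition Rep_eq :: "'l itself \<Rightarrow> group_eqs \<Rightarrow> 'v lterm \<Rightarrow> 'v lterm \<Rightarrow> bool" where
  "Rep_eq T \<Sigma> s t \<longleftrightarrow>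
     (\<forall>L \<in> (Rep \<Sigma> :: 'l lgrp set). \<forall>a \<in> UNIV \<rightarrow> carrier L. leval L a s = leval L a t)"

definition Rep_le :: "'l itself \<Rightarrow> group_eqs \<Rightarrow> 'v lterm \<Rightarrow> 'v lterm \<Rightarrow> bool" where
  "Rep_le T \<Sigma> s t \<longleftrightarrow> Rep_eq T \<Sigma> (LMeet s t) s"

definition word_term :: "'x word \<Rightarrow> 'x lterm" where
  "word_term w = foldr (\<lambda>(x, b) t. LMult (if b then LVar x else LInv (LVar x)) t) w LOne"

text \<open>Only meant for nonempty lists.\<close>

definition big_join :: "'v lterm list \<Rightarrow> 'v lterm" where
  "big_join ts = foldl LJoin (hd ts) (tl ts)"


section \<open>Decidability\<close>

text \<open>The total recursive functions of each arity: the closure of the initial functions under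
  composition, primitive recursion and minimization of regular functions.  The values of a
  function of arity \<open>n\<close> at lists of a length other than \<open>n\<close> are irrelevant.\<close>

inductive recursive :: "nat \<Rightarrow> (nat list \<Rightarrow> nat) \<Rightarrow> bool" where
  zero: "recursive n (\<lambda>xs. 0)"
| succ: "recursive 1 (\<lambda>xs. Suc (hd xs))"
| proj: "i < n \<Longrightarrow> recursive n (\<lambda>xs. xs ! i)"
| comp: "\<lbrakk>recursive (length hs) g; \<forall>h \<in> set hs. recursive n h\<rbrakk>
    \<Longrightarrow> recursive n (\<lambda>xs. g (map (\<lambda>h. h xs) hs))"
| prec: "\<lbrakk>recursive n g; recursive (Suc (Suc n)) h\<rbrakk>
    \<Longrightarrow> recursive (Suc n) (\<lambda>xs. rec_nat (g (tl xs)) (\<lambda>k r. h (k # r # tl xs)) (hd xs))"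
| mini: "\<lbrakk>recursive (Suc n) g; \<forall>xs. length xs = n \<longrightarrow> (\<exists>k. g (k # xs) = 0)\<rbrakk>
    \<Longrightarrow> recursive n (\<lambda>xs. LEAST k. g (k # xs) = 0)"

definition decidable_via :: "('p \<Rightarrow> nat) \<Rightarrow> ('p \<Rightarrow> bool) \<Rightarrow> bool" where
  "decidable_via code P \<longleftrightarrow>
     (\<exists>f. recursive 1 f \<and> (\<forall>p. f [code p] = (if P p then 1 else 0)))"

definition word_code :: "nat word \<Rightarrow> nat" where
  "word_code w = list_encode (map (\<lambda>(x, b). prod_encode (x, of_bool b)) w)"

primrec lterm_code :: "nat lterm \<Rightarrow> nat" where
  "lterm_code (LVar v) = prod_encode (0, v)"
| "lterm_code LOne = prod_encode (1, 0)"
| "lterm_code (LInv t) = prod_encode (2, lterm_code t)"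
| "lterm_code (LMult s t) = prod_encode (3, prod_encode (lterm_code s, lterm_code t))"
| "lterm_code (LMeet s t) = prod_encode (4, prod_encode (lterm_code s, lterm_code t))"
| "lterm_code (LJoin s t) = prod_encode (5, prod_encode (lterm_code s, lterm_code t))"

text \<open>An instance is a list of arbitrary, not necessarily reduced, group words.\<close>

definition normal_identity_problem :: "group_eqs \<Rightarrow> nat word list \<Rightarrow> bool" where
  "normal_identity_problem \<Sigma> ws \<longleftrightarrow>
     \<one>\<^bsub>rel_free_group \<Sigma> (UNIV :: nat set)\<^esub> \<in>
       normal_subsemigroup (rel_free_group \<Sigma> UNIV) (set (map (\<lambda>w. rel_class \<Sigma> UNIV (reduce w)) ws))"

definition normal_identity_problem_decidable :: "group_eqs \<Rightarrow> bool" where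
  "normal_identity_problem_decidable \<Sigma> \<longleftrightarrow>
     decidable_via (\<lambda>ws. list_encode (map word_code ws)) (normal_identity_problem \<Sigma>)"

definition equational_theory_decidable :: "'l itself \<Rightarrow> group_eqs \<Rightarrow> bool" where
  "equational_theory_decidable T \<Sigma> \<longleftrightarrow>
     decidable_via (\<lambda>(s, t). prod_encode (lterm_code s, lterm_code t)) (\<lambda>(s, t). Rep_eq T \<Sigma> s t)"

section \<open>The relatively free groups have the universal property\<close>

lemma opp_opp [simp]: "opp (opp l) = l"
  by (simp add: opp_def)

lemma opp_eq_iff: "opp l = l' \<longleftrightarrow> l = opp l'"
  by auto

lemma reduced_Nil [simp]: "reduced []"
  by (simp add: reduced_def)

lemma reduced_ConsD: "reduced (l # w) \<Longrightarrow> reduced w"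
  by (auto simp: reduced_def successively_Cons)

lemma reduced_push: "reduced w \<Longrightarrow> reduced (push l w)"
  by (cases w) (auto simp: reduced_def successively_Cons)

lemma push_reduced: "reduced (l # w) \<Longrightarrow> push l w = l # w"
  by (cases w) (auto simp: reduced_def successively_Cons)

lemma push_push_opp: "reduced w \<Longrightarrow> push l (push (opp l) w) = w"
  by (cases w) (auto simp: push_reduced)

lemma reduced_foldr_push: "reduced r \<Longrightarrow> reduced (foldr push w r)"
  by (induction w) (auto intro: reduced_push)

lemma reduced_reduce [simp]: "reduced (reduce w)"
  by (simp add: reduce_def reduced_foldr_push)

lemma reduce_reduced: "reduced w \<Longrightarrow> reduce w = w"
proof (induction w)
  case (Cons l w)
  then show ?case using push_reduced[OF Cons.prems] reduced_ConsD[OF Cons.prems]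
    by (simp add: reduce_def)
qed (simp add: reduce_def)

lemma foldr_push_push:
  assumes "reduced r" shows "foldr push (push l u) r = push l (foldr push u r)"
proof (cases u)
  case (Cons l' u')
  then show ?thesis
    using push_push_opp[OF reduced_foldr_push[OF assms]] by auto
qed simp

lemma foldr_push_reduce: "reduced r \<Longrightarrow> foldr push (reduce u) r = foldr push u r"
  by (induction u) (simp_all add: reduce_def foldr_push_push)

lemma reduce_append_reduce: "reduce (u @ reduce v) = reduce (u @ v)"
proof -
  have "reduce (u @ w) = foldr push u (reduce w)" for w :: "'a word"
    by (simp add: reduce_def)
  then show ?thesis by (simp add: reduce_reduced)
qed

lemma reduce_reduce_append: "reduce (reduce u @ v) = reduce (u @ v)"
  using foldr_push_reduce[OF reduced_foldr_push[OF reduced_Nil]] by (simp add: reduce_def)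

lemma foldr_push_inverse:
  "reduced r \<Longrightarrow> foldr push (rev (map opp w)) (foldr push w r) = r"
proof (induction w arbitrary: r)
  case (Cons l w)
  then show ?case
    using push_push_opp[of "foldr push w r" "opp l"] by (simp add: reduced_foldr_push)
qed simp

lemma letters_push: "set (push l w) \<subseteq> insert l (set w)"
  by (cases w) auto

lemma letters_reduce: "set (reduce w) \<subseteq> set w"
proof (induction w)
  case (Cons l w)
  then show ?case using letters_push[of l "reduce w"] by (auto simp: reduce_def)
qed (simp add: reduce_def)

lemma group_free_group: "group (free_group X)"
proof (rule groupI)
  fix u v w assume "u \<in> carrier (free_group X)" "v \<in> carrier (free_group X)"
    "w \<in> carrier (free_group X)"
  show "u \<otimes>\<^bsub>free_group X\<^esub> v \<otimes>\<^bsub>free_group X\<^esub> w =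
    u \<otimes>\<^bsub>free_group X\<^esub> (v \<otimes>\<^bsub>free_group X\<^esub> w)"
    by (simp add: free_group_def reduce_append_reduce reduce_reduce_append)
next
  fix u v assume "u \<in> carrier (free_group X)" "v \<in> carrier (free_group X)"
  then show "u \<otimes>\<^bsub>free_group X\<^esub> v \<in> carrier (free_group X)"
    using letters_reduce[of "u @ v"] by (fastforce simp: free_group_def)
next
  fix w assume w: "w \<in> carrier (free_group X)"
  let ?v = "rev (map opp w)"
  have "successively (\<lambda>x y. x \<noteq> opp y) w"
    using w by (auto simp: free_group_def reduced_def opp_eq_iff elim: successively_mono)
  then have "reduced ?v"
    by (auto simp: reduced_def successively_map opp_eq_iff elim: successively_mono)
  moreover have "reduce (?v @ w) = []"
    using foldr_push_inverse[of "[]" w] by (simp add: reduce_def)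
  moreover have "fst ` set ?v \<subseteq> X"
    using w by (auto simp: free_group_def opp_def)
  ultimately show "\<exists>v \<in> carrier (free_group X). v \<otimes>\<^bsub>free_group X\<^esub> w = \<one>\<^bsub>free_group X\<^esub>"
    by (intro bexI[of _ ?v]) (simp_all add: free_group_def)
qed (simp_all add: free_group_def reduce_reduced)

lemma geval_closed:
  assumes "group G" "a \<in> UNIV \<rightarrow> carrier G" shows "geval G a t \<in> carrier G"
proof -
  interpret group G by fact
  show ?thesis using assms(2) by (induction t) auto
qed

lemma geval_hom:
  assumes "group G" "group H" "h \<in> hom G H" "a \<in> UNIV \<rightarrow> carrier G"
  shows "h (geval G a t) = geval H (h \<circ> a) t"
proof -
  interpret group_hom G H h using assms by (simp add: group_hom_def group_hom_axioms_def)
  show ?thesis using geval_closed[OF assms(1,4)] by (induction t) simp_all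
qed

lemma verbal_generators:
  "{geval (free_group X) a s \<otimes>\<^bsub>free_group X\<^esub> inv\<^bsub>free_group X\<^esub> (geval (free_group X) a t) | s t a.
     (s, t) \<in> \<Sigma> \<and> a \<in> UNIV \<rightarrow> carrier (free_group X)} \<subseteq> carrier (free_group X)"
proof -
  interpret group "free_group X" by (rule group_free_group)
  show ?thesis using geval_closed[OF is_group] by blast
qed

lemma normal_verbal: "verbal \<Sigma> X \<lhd> free_group X"
proof -
  let ?F = "free_group X"
  interpret group ?F by (rule group_free_group)
  show ?thesis
    unfolding verbal_def
  proof (rule normal_generateI[OF verbal_generators])
    fix h g assume g: "g \<in> carrier ?F" and "h \<in> {geval ?F a s \<otimes>\<^bsub>?F\<^esub> inv\<^bsub>?F\<^esub> (geval ?F a t) | s t a.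
      (s, t) \<in> \<Sigma> \<and> a \<in> UNIV \<rightarrow> carrier ?F}"
    then obtain s t a where st: "(s, t) \<in> \<Sigma>" and a: "a \<in> UNIV \<rightarrow> carrier ?F"
      and h: "h = geval ?F a s \<otimes>\<^bsub>?F\<^esub> inv\<^bsub>?F\<^esub> (geval ?F a t)" by blast
    define c where "c x = g \<otimes>\<^bsub>?F\<^esub> x \<otimes>\<^bsub>?F\<^esub> inv\<^bsub>?F\<^esub> g" for x
    have c: "c \<in> hom ?F ?F"
    proof (rule homI)
      fix x y assume xy: "x \<in> carrier ?F" "y \<in> carrier ?F"
      have "inv\<^bsub>?F\<^esub> g \<otimes>\<^bsub>?F\<^esub> (g \<otimes>\<^bsub>?F\<^esub> z) = z" if "z \<in> carrier ?F" for z
        using that g by (simp flip: m_assoc)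
      then show "c (x \<otimes>\<^bsub>?F\<^esub> y) = c x \<otimes>\<^bsub>?F\<^esub> c y"
        using g xy by (simp add: c_def m_assoc)
    qed (use g in \<open>simp add: c_def\<close>)
    interpret c: group_hom ?F ?F c using c by unfold_locales
    have "c h = geval ?F (c \<circ> a) s \<otimes>\<^bsub>?F\<^esub> inv\<^bsub>?F\<^esub> (geval ?F (c \<circ> a) t)"
      using geval_closed[OF is_group a] by (simp add: h flip: geval_hom[OF is_group is_group c a])
    moreover have "c \<circ> a \<in> UNIV \<rightarrow> carrier ?F" using a c by (auto simp: hom_def Pi_iff)
    ultimately show "g \<otimes>\<^bsub>?F\<^esub> h \<otimes>\<^bsub>?F\<^esub> inv\<^bsub>?F\<^esub> g \<in> {geval ?F a s \<otimes>\<^bsub>?F\<^esub> inv\<^bsub>?F\<^esub> (geval ?F a t) | s t a.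
      (s, t) \<in> \<Sigma> \<and> a \<in> UNIV \<rightarrow> carrier ?F}"
      using st unfolding c_def by blast
  qed
qed

lemma group_rel_free_group: "group (rel_free_group \<Sigma> X)"
  unfolding rel_free_group_def by (rule normal.factorgroup_is_group[OF normal_verbal])

lemma rel_class_hom: "rel_class \<Sigma> X \<in> hom (free_group X) (rel_free_group \<Sigma> X)"
  unfolding rel_free_group_def rel_class_def
  by (rule normal.r_coset_hom_Mod[OF normal_verbal])

lemma carrier_rel_free_group:
  "carrier (rel_free_group \<Sigma> X) = rel_class \<Sigma> X ` carrier (free_group X)"
  by (simp add: rel_free_group_def carrier_FactGroup rel_class_def)

lemma rel_free_group_satisfies: "satisfies (rel_free_group \<Sigma> X) \<Sigma>"
proof -
  let ?F = "free_group X" and ?R = "rel_free_group \<Sigma> X" and ?c = "rel_class \<Sigma> X"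
  interpret F: group ?F by (rule group_free_group)
  interpret N: normal "verbal \<Sigma> X" ?F by (rule normal_verbal)
  have "geval ?R a s = geval ?R a t" if st: "(s, t) \<in> \<Sigma>" and a: "a \<in> UNIV \<rightarrow> carrier ?R" for s t a
  proof -
    have "\<forall>v. \<exists>w \<in> carrier ?F. a v = ?c w" using a by (auto simp: carrier_rel_free_group Pi_iff)
    then obtain b where b: "b \<in> UNIV \<rightarrow> carrier ?F" "\<And>v. a v = ?c (b v)"
      unfolding Pi_iff by metis
    then have ab: "a = ?c \<circ> b" by auto
    have "geval ?F b s \<otimes>\<^bsub>?F\<^esub> inv\<^bsub>?F\<^esub> (geval ?F b t) \<in> verbal \<Sigma> X"
      unfolding verbal_def using st b(1) by (blast intro: generate.incl)
    then have "?c (geval ?F b s) = ?c (geval ?F b t)"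
      unfolding rel_class_def using geval_closed[OF F.is_group b(1)]
      by (metis F.coset_join2 F.coset_mult_inv1 F.group_l_invI F.inv_closed F.m_closed
          N.subgroup_axioms N.subset F.coset_mult_inv2)
    then show ?thesis
      by (simp add: ab flip: geval_hom[OF F.is_group group_rel_free_group rel_class_hom b(1)])
  qed
  then show ?thesis by (auto simp: satisfies_def)
qed

definition word_eval :: "('a, 'm) monoid_scheme \<Rightarrow> ('x \<Rightarrow> 'a) \<Rightarrow> 'x word \<Rightarrow> 'a" where
  "word_eval G f w = foldr (\<lambda>(x, b) y. (if b then f x else inv\<^bsub>G\<^esub> f x) \<otimes>\<^bsub>G\<^esub> y) w \<one>\<^bsub>G\<^esub>"

lemma word_eval_simps [simp]:
  "word_eval G f [] = \<one>\<^bsub>G\<^esub>"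
  "word_eval G f ((x, b) # w) = (if b then f x else inv\<^bsub>G\<^esub> f x) \<otimes>\<^bsub>G\<^esub> word_eval G f w"
  by (simp_all add: word_eval_def)

lemma word_eval_hom:
  assumes "group G" "f \<in> X \<rightarrow> carrier G"
  shows "word_eval G f \<in> hom (free_group X) G"
proof -
  interpret group G by fact
  have cl: "word_eval G f w \<in> carrier G" if "fst ` set w \<subseteq> X" for w
    using that assms(2) by (induction w) (auto simp: Pi_iff)
  have app: "word_eval G f (u @ v) = word_eval G f u \<otimes>\<^bsub>G\<^esub> word_eval G f v"
    if "fst ` set u \<subseteq> X" "fst ` set v \<subseteq> X" for u v
    using that
  proof (induction u)
    case (Cons l u)
    have "(if snd l then f (fst l) else inv\<^bsub>G\<^esub> f (fst l)) \<in> carrier G"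
      using Cons.prems assms(2) by auto
    moreover have "word_eval G f u \<in> carrier G" "word_eval G f v \<in> carrier G"
      using Cons.prems cl by auto
    ultimately show ?case using Cons by (cases l) (auto simp: m_assoc)
  qed (simp add: cl)
  have pu: "word_eval G f (push l w) = word_eval G f (l # w)"
    if "fst ` set (l # w) \<subseteq> X" for l w
  proof (cases w)
    case (Cons l' w')
    obtain x b where l: "l = (x, b)" by force
    have x: "f x \<in> carrier G" and w': "word_eval G f w' \<in> carrier G"
      using that assms(2) cl by (auto simp: l Cons)
    show ?thesis
    proof (cases "l' = opp l")
      case True
      then show ?thesis using x w' by (auto simp: l Cons opp_def simp flip: m_assoc)
    qed (simp add: Cons)
  qed simp
  have re: "word_eval G f (reduce w) = word_eval G f w" if "fst ` set w \<subseteq> X" for w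
    using that
  proof (induction w)
    case (Cons l w)
    have "fst ` set (l # reduce w) \<subseteq> X"
      using Cons.prems letters_reduce[of w] by auto
    from pu[OF this] have "word_eval G f (reduce (l # w)) = word_eval G f (l # reduce w)"
      by (simp add: reduce_def)
    then show ?case using Cons by (cases l) simp
  qed (simp add: reduce_def)
  show ?thesis
    by (rule homI) (auto simp: free_group_def cl app re image_Un)
qed

lemma generator_in_free_group: "x \<in> X \<Longrightarrow> [(x, b)] \<in> carrier (free_group X)"
  by (simp add: free_group_def reduced_def)

theorem rel_free_group_universal:
  assumes "group G" "satisfies G \<Sigma>" "f \<in> X \<rightarrow> carrier G"
  shows "\<exists>h \<in> hom (rel_free_group \<Sigma> X) G. \<forall>x \<in> X. h (rel_class \<Sigma> X [(x, True)]) = f x"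
proof -
  let ?F = "free_group X" and ?e = "word_eval G f"
  interpret G: group G by fact
  interpret F: group ?F by (rule group_free_group)
  interpret N: normal "verbal \<Sigma> X" ?F by (rule normal_verbal)
  interpret e: group_hom ?F G ?e
    using word_eval_hom[OF assms(1,3)] by unfold_locales
  have inst: "?e (geval ?F a s \<otimes>\<^bsub>?F\<^esub> inv\<^bsub>?F\<^esub> (geval ?F a t)) = \<one>\<^bsub>G\<^esub>"
    if "(s, t) \<in> \<Sigma>" "a \<in> UNIV \<rightarrow> carrier ?F" for s t a
  proof -
    have "?e \<circ> a \<in> UNIV \<rightarrow> carrier G"
      using that(2) e.homh by (auto simp: hom_def Pi_iff)
    then have "geval G (?e \<circ> a) s = geval G (?e \<circ> a) t"
      using that(1) assms(2) unfolding satisfies_def by blast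
    then have "?e (geval ?F a s) = ?e (geval ?F a t)"
      by (simp add: geval_hom[OF F.is_group assms(1) e.homh that(2)])
    then show ?thesis using geval_closed[OF F.is_group that(2)] by simp
  qed
  have ker: "verbal \<Sigma> X \<subseteq> kernel ?F G ?e"
    unfolding verbal_def
    by (rule F.generate_subgroup_incl[OF _ e.subgroup_kernel])
       (use verbal_generators[of X \<Sigma>] inst in \<open>auto simp: kernel_def\<close>)
  have eq: "?e u = ?e v" if uv: "u \<in> carrier ?F" "v \<in> carrier ?F"
    "verbal \<Sigma> X #>\<^bsub>?F\<^esub> u = verbal \<Sigma> X #>\<^bsub>?F\<^esub> v" for u v
  proof -
    have "u \<in> verbal \<Sigma> X #>\<^bsub>?F\<^esub> v" using F.rcos_self[OF uv(1) N.subgroup_axioms] uv(3) by simp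
    then obtain n where "n \<in> verbal \<Sigma> X" "u = n \<otimes>\<^bsub>?F\<^esub> v" by (auto simp: r_coset_def)
    then show ?thesis using ker uv(2) by (auto simp: kernel_def)
  qed
  obtain h where h: "h \<in> hom (?F Mod verbal \<Sigma> X) G"
    "\<And>u. u \<in> carrier ?F \<Longrightarrow> h (verbal \<Sigma> X #>\<^bsub>?F\<^esub> u) = ?e u"
    using FactGroup_universal[OF e.homh normal_verbal, of \<Sigma>] eq by metis
  have "h (rel_class \<Sigma> X [(x, True)]) = f x" if "x \<in> X" for x
    using h(2)[OF generator_in_free_group[OF that]] that assms(3)
    by (auto simp: rel_class_def Pi_iff)
  then show ?thesis using h(1) by (auto simp: rel_free_group_def)
qed

theorem rel_free_group_hom_unique:
  assumes "group G" "h \<in> hom (rel_free_group \<Sigma> X) G" "k \<in> hom (rel_free_group \<Sigma> X) G"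
    and eq: "\<And>x. x \<in> X \<Longrightarrow> h (rel_class \<Sigma> X [(x, True)]) = k (rel_class \<Sigma> X [(x, True)])"
    and "a \<in> carrier (rel_free_group \<Sigma> X)"
  shows "h a = k a"
proof -
  let ?F = "free_group X" and ?R = "rel_free_group \<Sigma> X" and ?c = "rel_class \<Sigma> X"
  interpret F: group ?F by (rule group_free_group)
  interpret R: group ?R by (rule group_rel_free_group)
  interpret c: group_hom ?F ?R ?c using rel_class_hom by unfold_locales
  interpret G: group G by fact
  interpret h: group_hom ?R G h using assms(2) by unfold_locales
  interpret k: group_hom ?R G k using assms(3) by unfold_locales
  have letter: "h (?c [(x, b)]) = k (?c [(x, b)])" if x: "x \<in> X" for x b
  proof (cases b)
    case False
    have "[(x, False)] \<otimes>\<^bsub>?F\<^esub> [(x, True)] = \<one>\<^bsub>?F\<^esub>"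
      by (simp add: free_group_def reduce_def opp_def)
    then have "[(x, False)] = inv\<^bsub>?F\<^esub> [(x, True)]"
      using x by (metis F.inv_equality generator_in_free_group)
    then show ?thesis using False eq[OF x] generator_in_free_group[OF x] by simp
  qed (simp add: eq x)
  have "h (?c w) = k (?c w)" if "w \<in> carrier ?F" for w
    using that
  proof (induction w)
    case Nil
    have "[] = \<one>\<^bsub>?F\<^esub>" by (simp add: free_group_def)
    then show ?case by (metis c.hom_one h.hom_one k.hom_one)
  next
    case (Cons l w)
    have l: "fst l \<in> X" and w: "w \<in> carrier ?F"
      using Cons.prems by (auto simp: free_group_def dest: reduced_ConsD)
    have "l # w = [l] \<otimes>\<^bsub>?F\<^esub> w"
      using Cons.prems by (simp add: free_group_def reduce_reduced)
    then show ?case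
      using Cons.IH[OF w] w letter[OF l, of "snd l"] generator_in_free_group[OF l, of "snd l"]
      by simp
  qed
  then show ?thesis using assms(5) by (auto simp: carrier_rel_free_group)
qed


section \<open>Independence of the carrier types\<close>

lemma lhom_hom: "h \<in> lhom L M \<Longrightarrow> h \<in> hom L M"
  by (simp add: lhom_def)

lemma leval_closed:
  assumes "l_group L" "a \<in> UNIV \<rightarrow> carrier L" shows "leval L a t \<in> carrier L"
proof -
  interpret l_group L by fact
  show ?thesis using assms(2) by (induction t) (auto simp: meet_closed join_closed)
qed

lemma leval_hom:
  assumes "l_group L" "l_group M" "h \<in> lhom L M" "a \<in> UNIV \<rightarrow> carrier L"
  shows "h (leval L a t) = leval M (h \<circ> a) t"
proof -
  interpret L: l_group L by fact
  interpret M: l_group M by fact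
  interpret group_hom L M h using lhom_hom[OF assms(3)] by unfold_locales
  show ?thesis
    using leval_closed[OF assms(1,4)] assms(3) by (induction t) (simp_all add: lhom_def)
qed

lemma leval_cong:
  "(\<And>v. v \<in> set_lterm t \<Longrightarrow> a v = b v) \<Longrightarrow> leval L a t = leval L b t"
  by (induction t) simp_all

definition transport_lgrp :: "('a, 'm) lgrp_scheme \<Rightarrow> 'a set \<Rightarrow> ('a \<Rightarrow> 'b) \<Rightarrow> 'b lgrp" where
  "transport_lgrp L A h =
    \<lparr> carrier = h ` A,
      mult = (\<lambda>x y. h (inv_into A h x \<otimes>\<^bsub>L\<^esub> inv_into A h y)),
      one = h \<one>\<^bsub>L\<^esub>,
      lmeet = (\<lambda>x y. h (lmeet L (inv_into A h x) (inv_into A h y))),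
      ljoin = (\<lambda>x y. h (ljoin L (inv_into A h x) (inv_into A h y))) \<rparr>"

definition sub_lgrp :: "('a, 'm) lgrp_scheme \<Rightarrow> 'a set \<Rightarrow> bool" where
  "sub_lgrp L A \<longleftrightarrow> subgroup A L \<and>
     (\<forall>x \<in> A. \<forall>y \<in> A. lmeet L x y \<in> A \<and> ljoin L x y \<in> A)"

lemma transport_simps:
  assumes "sub_lgrp L A" "inj_on h A"
  shows "carrier (transport_lgrp L A h) = h ` A"
    "\<one>\<^bsub>transport_lgrp L A h\<^esub> = h \<one>\<^bsub>L\<^esub>"
    "\<lbrakk>x \<in> A; y \<in> A\<rbrakk> \<Longrightarrow> h x \<otimes>\<^bsub>transport_lgrp L A h\<^esub> h y = h (x \<otimes>\<^bsub>L\<^esub> y)"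
    "\<lbrakk>x \<in> A; y \<in> A\<rbrakk> \<Longrightarrow> lmeet (transport_lgrp L A h) (h x) (h y) = h (lmeet L x y)"
    "\<lbrakk>x \<in> A; y \<in> A\<rbrakk> \<Longrightarrow> ljoin (transport_lgrp L A h) (h x) (h y) = h (ljoin L x y)"
  using assms(2) by (simp_all add: transport_lgrp_def)

lemma
  assumes "l_group L" and sub: "sub_lgrp L A" and inj: "inj_on h A"
  shows l_group_transport: "l_group (transport_lgrp L A h)"
    and transport_inv_lhom: "inv_into A h \<in> lhom (transport_lgrp L A h) L"
proof -
  interpret l_group L by fact
  interpret A: subgroup A L using sub by (simp add: sub_lgrp_def)
  note [simp] = transport_simps[OF sub inj] inj_on_eq_iff[OF inj] inv_into_f_f[OF inj]
  have [simp]: "lmeet L x y \<in> A" "ljoin L x y \<in> A" if "x \<in> A" "y \<in> A" for x y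
    using sub that by (simp_all add: sub_lgrp_def)
  have [intro]: "lmeet L x y = lmeet L y x" "ljoin L x y = ljoin L y x"
    if "x \<in> A" "y \<in> A" for x y
    using that meet_commute join_commute by simp_all
  let ?T = "transport_lgrp L A h"
  have "group ?T"
  proof (rule groupI)
    fix x assume "x \<in> carrier ?T"
    then obtain y where y: "y \<in> A" "x = h y" by auto
    then show "\<exists>z \<in> carrier ?T. z \<otimes>\<^bsub>?T\<^esub> x = \<one>\<^bsub>?T\<^esub>"
      by (intro bexI[of _ "h (inv\<^bsub>L\<^esub> y)"]) simp_all
  qed (auto simp: m_assoc)
  moreover have "l_group_axioms ?T"
  proof
    fix a b c d assume "a \<in> carrier ?T" "b \<in> carrier ?T" "c \<in> carrier ?T" "d \<in> carrier ?T" "lle ?T a b"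
    then show "lle ?T (c \<otimes>\<^bsub>?T\<^esub> a \<otimes>\<^bsub>?T\<^esub> d) (c \<otimes>\<^bsub>?T\<^esub> b \<otimes>\<^bsub>?T\<^esub> d)"
      using translate by (auto simp: lle_def)
  qed (auto simp: meet_assoc join_assoc meet_join_absorb join_meet_absorb)
  ultimately show "l_group ?T" by (simp add: l_group_def)
  show "inv_into A h \<in> lhom ?T L"
    by (auto simp: lhom_def hom_def)
qed

lemma inj_transport_inv: "inj_on (inv_into A h) (carrier (transport_lgrp L A h))"
  by (auto simp: transport_lgrp_def intro: inj_on_inv_into)

lemma ordered_l_group_transport:
  assumes "ordered_l_group L" "sub_lgrp L A" "inj_on h A"
  shows "ordered_l_group (transport_lgrp L A h)"
proof -
  interpret ordered_l_group L by fact
  interpret A: subgroup A L using assms(2) by (simp add: sub_lgrp_def)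
  have "ordered_l_group_axioms (transport_lgrp L A h)"
  proof
    fix x y assume "x \<in> carrier (transport_lgrp L A h)" "y \<in> carrier (transport_lgrp L A h)"
    then obtain u v where uv: "u \<in> A" "v \<in> A" "x = h u" "y = h v"
      by (auto simp: transport_lgrp_def)
    then have "lle L u v \<or> lle L v u" using total by simp
    then show "lle (transport_lgrp L A h) x y \<or> lle (transport_lgrp L A h) y x"
      using uv by (auto simp: lle_def transport_simps[OF assms(2,3)])
  qed
  then show ?thesis
    using l_group_transport[OF l_group_axioms assms(2,3)] by (simp add: ordered_l_group_def)
qed

lemma sub_lgrp_image:
  assumes "l_group L" "l_group M" "h \<in> lhom L M"
  shows "sub_lgrp M (h ` carrier L)"
proof -
  interpret L: l_group L by fact
  interpret M: l_group M by fact
  interpret group_hom L M h using lhom_hom[OF assms(3)] by unfold_locales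
  have "lmeet M (h x) (h y) \<in> h ` carrier L" "ljoin M (h x) (h y) \<in> h ` carrier L"
    if xy: "x \<in> carrier L" "y \<in> carrier L" for x y
  proof -
    have "lmeet M (h x) (h y) = h (lmeet L x y)" "ljoin M (h x) (h y) = h (ljoin L x y)"
      using assms(3) xy by (simp_all add: lhom_def)
    then show "lmeet M (h x) (h y) \<in> h ` carrier L" "ljoin M (h x) (h y) \<in> h ` carrier L"
      using L.meet_closed[OF xy] L.join_closed[OF xy] by simp_all
  qed
  then show ?thesis using img_is_subgroup by (auto simp: sub_lgrp_def)
qed

lemma product_lgrp_simps [simp]:
  "carrier (product_lgrp I M) = (\<Pi>\<^sub>E i\<in>I. carrier (M i))"
  "x \<otimes>\<^bsub>product_lgrp I M\<^esub> y = (\<lambda>i\<in>I. x i \<otimes>\<^bsub>M i\<^esub> y i)"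
  "\<one>\<^bsub>product_lgrp I M\<^esub> = (\<lambda>i\<in>I. \<one>\<^bsub>M i\<^esub>)"
  "lmeet (product_lgrp I M) x y = (\<lambda>i\<in>I. lmeet (M i) (x i) (y i))"
  "ljoin (product_lgrp I M) x y = (\<lambda>i\<in>I. ljoin (M i) (x i) (y i))"
  by (simp_all add: product_lgrp_def product_group_def monoid.extend_def)

lemma subdirect_embedding_component:
  assumes "subdirect_embedding L I M \<phi>" "i \<in> I"
  shows "(\<lambda>x. \<phi> x i) \<in> lhom L (M i)"
  using assms by (simp add: subdirect_embedding_def lhom_def hom_def Pi_iff PiE_iff)

lemma subdirect_embedding_separates:
  assumes "subdirect_embedding L I M \<phi>" "x \<in> carrier L" "y \<in> carrier L"
    and "\<And>i. i \<in> I \<Longrightarrow> \<phi> x i = \<phi> y i"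
  shows "x = y"
proof -
  have "\<phi> x \<in> (\<Pi>\<^sub>E i\<in>I. carrier (M i))" "\<phi> y \<in> (\<Pi>\<^sub>E i\<in>I. carrier (M i))"
    using assms by (auto simp: subdirect_embedding_def lhom_def hom_def Pi_iff)
  then have "\<phi> x = \<phi> y" using assms(4) by (rule PiE_ext)
  then show ?thesis using assms by (auto simp: subdirect_embedding_def inj_on_def)
qed

lemma representable_if_separated:
  fixes L :: "'a lgrp" and M :: "'i \<Rightarrow> ('b, 'm) lgrp_scheme"
  assumes L: "l_group L"
    and M: "\<And>i. i \<in> I \<Longrightarrow> ordered_l_group (M i)"
    and f: "\<And>i. i \<in> I \<Longrightarrow> f i \<in> lhom L (M i)"
    and sep: "\<And>x y. \<lbrakk>x \<in> carrier L; y \<in> carrier L; \<And>i. i \<in> I \<Longrightarrow> f i x = f i y\<rbrakk> \<Longrightarrow> x = y"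
  shows "representable L"
proof -
  interpret L: l_group L by fact
  have gh: "group_hom L (M i) (f i)" if "i \<in> I" for i
    using M[OF that] lhom_hom[OF f[OF that]] L.is_group
    by (simp add: group_hom_def group_hom_axioms_def ordered_l_group_def l_group_def)
  define J where "J = carrier L - {\<one>\<^bsub>L\<^esub>}"
  have "\<exists>i \<in> I. f i x \<noteq> \<one>\<^bsub>M i\<^esub>" if "x \<in> J" for x
    using that sep[of x "\<one>\<^bsub>L\<^esub>"] group_hom.hom_one[OF gh] unfolding J_def by force
  then obtain k where k: "\<And>x. x \<in> J \<Longrightarrow> k x \<in> I" "\<And>x. x \<in> J \<Longrightarrow> f (k x) x \<noteq> \<one>\<^bsub>M (k x)\<^esub>"
    by metis
  define A where "A x = f (k x) ` carrier L" for x
  define r where "r x = inv_into (carrier L) (f (k x))" for x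
  define N where "N x = transport_lgrp (M (k x)) (A x) (r x)" for x
  define \<phi> where "\<phi> y = (\<lambda>x\<in>J. r x (f (k x) y))" for y
  have lM: "l_group (M (k x))" if "x \<in> J" for x
    using M[OF k(1)[OF that]] by (simp add: ordered_l_group_def)
  have A: "sub_lgrp (M (k x)) (A x)" if "x \<in> J" for x
    unfolding A_def using sub_lgrp_image[OF L lM[OF that] f[OF k(1)[OF that]]] .
  have r: "inj_on (r x) (A x)" for x
    unfolding r_def A_def by (rule inj_on_inv_into) simp
  have N: "ordered_l_group (N x)" if "x \<in> J" for x
    unfolding N_def by (rule ordered_l_group_transport[OF M[OF k(1)[OF that]] A[OF that] r])
  have fA: "f (k x) y \<in> A x" if "y \<in> carrier L" for x y
    using that by (simp add: A_def)
  have Nc: "carrier (N x) = r x ` f (k x) ` carrier L" if "x \<in> J" for x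
    by (simp add: N_def A_def transport_lgrp_def)
  have hom: "r x (f (k x) (y \<otimes>\<^bsub>L\<^esub> z)) = r x (f (k x) y) \<otimes>\<^bsub>N x\<^esub> r x (f (k x) z)"
    "r x (f (k x) (lmeet L y z)) = lmeet (N x) (r x (f (k x) y)) (r x (f (k x) z))"
    "r x (f (k x) (ljoin L y z)) = ljoin (N x) (r x (f (k x) y)) (r x (f (k x) z))"
    if "x \<in> J" "y \<in> carrier L" "z \<in> carrier L" for x y z
    using transport_simps(3-5)[OF A[OF that(1)] r fA[OF that(2)] fA[OF that(3)]]
      f[OF k(1)[OF that(1)]] that(2,3)
    by (simp_all add: N_def lhom_def hom_def)
  have "\<phi> \<in> lhom L (product_lgrp J N)"
    using Nc hom by (auto simp: lhom_def hom_def \<phi>_def L.meet_closed L.join_closed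
        intro!: restrict_ext)
  moreover have "inj_on \<phi> (carrier L)"
  proof (rule inj_onI, rule ccontr)
    fix y z assume yz: "y \<in> carrier L" "z \<in> carrier L" "\<phi> y = \<phi> z" "y \<noteq> z"
    define x where "x = y \<otimes>\<^bsub>L\<^esub> inv\<^bsub>L\<^esub> z"
    have x: "x \<in> J"
      using yz L.inv_equality[of y "inv\<^bsub>L\<^esub> z"] by (auto simp: x_def J_def)
    interpret group_hom L "M (k x)" "f (k x)" by (rule gh[OF k(1)[OF x]])
    have "r x (f (k x) y) = r x (f (k x) z)"
      using fun_cong[OF yz(3), of x] x by (simp add: \<phi>_def)
    then have "f (k x) y = f (k x) z"
      using inj_onD[OF r] fA yz(1,2) by metis
    then have "f (k x) (y \<otimes>\<^bsub>L\<^esub> inv\<^bsub>L\<^esub> z) = \<one>\<^bsub>M (k x)\<^esub>" using yz(1,2) by simp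
    then show False using k(2)[OF x] by (simp flip: x_def)
  qed
  moreover have "(\<lambda>y. \<phi> y x) ` carrier L = carrier (N x)" if "x \<in> J" for x
    using that by (simp add: Nc \<phi>_def image_image)
  ultimately have "subdirect_embedding L J N \<phi>" by (simp add: subdirect_embedding_def)
  then show ?thesis using L N unfolding representable_def by blast
qed

theorem representable_if_subdirect:
  fixes L :: "'a lgrp" and M :: "'i \<Rightarrow> ('b, 'm) lgrp_scheme"
  assumes "l_group L" "\<And>i. i \<in> I \<Longrightarrow> ordered_l_group (M i)" "subdirect_embedding L I M \<phi>"
  shows "representable L"
proof (rule representable_if_separated[where I = I and M = M and f = "\<lambda>i x. \<phi> x i"])
  fix x y assume "x \<in> carrier L" "y \<in> carrier L" "\<And>i. i \<in> I \<Longrightarrow> \<phi> x i = \<phi> y i"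
  then show "x = y" by (rule subdirect_embedding_separates[OF assms(3)])
qed (use assms subdirect_embedding_component[OF assms(3)] in auto)

instance lterm :: (countable) countable
  by countable_datatype

theorem Rep_eq_all_types:
  fixes s t :: "'v lterm"
  assumes inf: "infinite (UNIV :: 'l set)" and "Rep_eq TYPE('l) \<Sigma> s t"
  shows "Rep_eq TYPE('m) \<Sigma> s t"
  unfolding Rep_eq_def
proof (intro ballI)
  fix L :: "'m lgrp" and a :: "'v \<Rightarrow> 'm"
  assume "L \<in> Rep \<Sigma>" and a: "a \<in> UNIV \<rightarrow> carrier L"
  then have rep: "representable L" and sat: "satisfies L \<Sigma>" by (simp_all add: Rep_def)
  obtain I :: "'m set" and M :: "'m \<Rightarrow> 'm lgrp" and \<phi>
    where L: "l_group L" and M: "\<And>i. i \<in> I \<Longrightarrow> ordered_l_group (M i)"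
      and \<phi>: "subdirect_embedding L I M \<phi>"
    using rep unfolding representable_def by blast
  interpret l_group L by fact
  define V where "V = insert undefined (set_lterm s \<union> set_lterm t)"
  have "finite V" by (simp add: V_def lterm.set_finite)
  then have V: "range (from_nat_into V) = V"
    by (intro range_from_nat_into) (auto simp: V_def countable_finite)
  define b where "b = a \<circ> from_nat_into V"
  have b: "b \<in> UNIV \<rightarrow> carrier L" using a by (auto simp: b_def)
  define A where "A = range (leval L b)"
  have A: "sub_lgrp L A"
    unfolding sub_lgrp_def
  proof (intro conjI ballI subgroupI)
    show "A \<subseteq> carrier L" using leval_closed[OF L b] by (auto simp: A_def)
    fix x y assume "x \<in> A" "y \<in> A"
    then obtain u v where "x = leval L b u" "y = leval L b v" by (auto simp: A_def)
    then have "inv\<^bsub>L\<^esub> x = leval L b (LInv u)" "x \<otimes>\<^bsub>L\<^esub> y = leval L b (LMult u v)"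
      "lmeet L x y = leval L b (LMeet u v)" "ljoin L x y = leval L b (LJoin u v)" by simp_all
    then show "inv\<^bsub>L\<^esub> x \<in> A" "x \<otimes>\<^bsub>L\<^esub> y \<in> A" "lmeet L x y \<in> A" "ljoin L x y \<in> A"
      unfolding A_def by (metis rangeI)+
  qed (simp add: A_def)
  obtain j :: "nat \<Rightarrow> 'l" where j: "inj j" using inf infinite_countable_subset by blast
  have "countable A" by (simp add: A_def)
  define h where "h = j \<circ> to_nat_on A"
  have h: "inj_on h A"
    unfolding h_def using j \<open>countable A\<close> by (metis comp_inj_on inj_on_subset inj_on_to_nat_on subset_UNIV)
  define T where "T = transport_lgrp L A h"
  define g where "g = inv_into A h"
  have T: "l_group T" and g: "g \<in> lhom T L" and injg: "inj_on g (carrier T)"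
    unfolding T_def g_def
    using l_group_transport[OF L A h] transport_inv_lhom[OF L A h] inj_transport_inv by blast+
  interpret T: l_group T by fact
  have gc: "g x \<in> carrier L" if "x \<in> carrier T" for x
    using that g by (auto simp: lhom_def hom_def)
  have "representable T"
  proof (rule representable_if_separated[where I = I and M = M and f = "\<lambda>i x. \<phi> (g x) i"])
    fix i assume "i \<in> I"
    then have "(\<lambda>x. \<phi> x i) \<in> lhom L (M i)" by (rule subdirect_embedding_component[OF \<phi>])
    then show "(\<lambda>x. \<phi> (g x) i) \<in> lhom T (M i)"
      using g gc by (auto simp: lhom_def hom_def)
  next
    fix x y assume xy: "x \<in> carrier T" "y \<in> carrier T" "\<And>i. i \<in> I \<Longrightarrow> \<phi> (g x) i = \<phi> (g y) i"
    have "g x = g y" using xy subdirect_embedding_separates[OF \<phi> gc gc] by blast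
    then show "x = y" using injg xy by (auto dest: inj_onD)
  qed (use T M in auto)
  moreover have "satisfies T \<Sigma>"
    unfolding satisfies_def
  proof (intro ballI, clarify, rule inj_onD[OF injg])
    fix u v and c :: "nat \<Rightarrow> 'l" assume uv: "(u, v) \<in> \<Sigma>" and c: "c \<in> UNIV \<rightarrow> carrier T"
    have "g \<circ> c \<in> UNIV \<rightarrow> carrier L" using gc c by (auto simp: Pi_iff)
    then have "geval L (g \<circ> c) u = geval L (g \<circ> c) v"
      using sat uv unfolding satisfies_def by blast
    then show "g (geval T c u) = g (geval T c v)"
      by (simp add: geval_hom[OF T.is_group is_group lhom_hom[OF g] c])
    show "geval T c u \<in> carrier T" "geval T c v \<in> carrier T"
      using geval_closed[OF T.is_group c] by auto
  qed
  ultimately have "T \<in> Rep \<Sigma>" by (simp add: Rep_def)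
  moreover define a' where "a' v = (if v \<in> V then h (a v) else \<one>\<^bsub>T\<^esub>)" for v
  have aA: "a v \<in> A" if "v \<in> V" for v
  proof -
    have "v \<in> range (from_nat_into V)" using that by (simp only: V)
    then obtain n where n: "v = from_nat_into V n" by (rule rangeE)
    have "a v = leval L b (LVar n)" by (simp only: b_def n leval.simps comp_apply)
    then show ?thesis unfolding A_def by (rule range_eqI)
  qed
  have a': "a' \<in> UNIV \<rightarrow> carrier T"
  proof
    fix v
    show "a' v \<in> carrier T"
      using aA[of v] transport_simps(1)[OF A h] T.one_closed by (simp add: a'_def T_def)
  qed
  ultimately have "leval T a' s = leval T a' t"
    using assms(2) unfolding Rep_eq_def by blast
  then have eq: "leval L (g \<circ> a') s = leval L (g \<circ> a') t"
    by (simp flip: leval_hom[OF T L g a'])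
  have "(g \<circ> a') v = a v" if "v \<in> V" for v
    using aA[OF that] h that by (simp add: a'_def g_def)
  then have "leval L (g \<circ> a') s = leval L a s" "leval L (g \<circ> a') t = leval L a t"
    by (intro leval_cong; simp add: V_def)+
  with eq show "leval L a s = leval L a t" by simp
qed

end

(* In a totally ordered group all elements of the normal subsemigroup generated by elements below
   the identity are below the identity, so the identity is not among them.  Conversely, if the
   identity is not in the normal subsemigroup N generated by S in a fully bi-orderable relatively
   free group, then a < b :<-> a b^-1 in N is a partial bi-order; any bi-order extending it makes the
   relatively free group a totally ordered member of Rep_Sigma in which all elements of S are below
   the identity.  This is part (a).

   For part (b), in a totally ordered group every term is a meet of joins of group words, hence an
   equation amounts to finitely many inequalities e <= w_1 v ... v w_n, which are instances of the
   Normal Identity Problem; the converse reduction is part (a).  Both reductions are recursive. *)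

theory Submission
  imports Defs
begin

text \<open>The relation puts a below b when a b^-1, and not b a^-1, lies in N, because a refutation
  of e \<le> t_1 v ... v t_n needs every t_i strictly below the identity: N has to land in the
  negative cone of the bi-order.

  The normal subsemigroup lives in a single group, whereas \<open>Rep_eq\<close> ranges over the
  l-groups on one fixed type. Both sides are compared with \<open>ordered_valid\<close>, the
  inequality read in totally ordered groups, where it is a disjunction. The refuting ordered group
  has elements of type \<open>'x word set\<close> and must be carried to the type \<open>'l\<close>.
  This works because an equation has finitely many variables, so that it is already refuted in a
  countable sub-l-group.

  In (b) the recursiveness of the reductions has to be proved for functions on lists of numbers. The
  predicate \<open>computable\<close> lifts it to functions between coded types, with closure rules
  that follow the syntax of a definition. Only the normal form of a term, a recursion on trees,
  needs an argument of its own: a recursion along the codes of terms.\<close>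

section \<open>Recursive functions\<close>

text \<open>Equality at the lists of the right length only, since \<open>recursive\<close> is not
  closed under changing a function at the irrelevant lists.\<close>

definition rec_on :: "nat \<Rightarrow> (nat list \<Rightarrow> nat) \<Rightarrow> bool" where
  "rec_on n f \<longleftrightarrow> (\<exists>g. recursive n g \<and> (\<forall>xs. length xs = n \<longrightarrow> g xs = f xs))"

lemma rec_onI: "recursive n f \<Longrightarrow> rec_on n f"
  by (auto simp: rec_on_def)

lemma rec_on_cong:
  assumes "rec_on n f" "\<And>xs. length xs = n \<Longrightarrow> f xs = g xs"
  shows "rec_on n g"
  using assms by (auto simp: rec_on_def)

lemma rec_on_proj: "i < n \<Longrightarrow> rec_on n (\<lambda>xs. xs ! i)"
  by (rule rec_onI) (rule recursive.proj)

lemma rec_on_comp1: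
  assumes "rec_on (Suc 0) (\<lambda>xs. f (hd xs))" "rec_on n a"
  shows "rec_on n (\<lambda>xs. f (a xs))"
proof -
  obtain g h where g: "recursive (Suc 0) g" "\<And>xs. length xs = Suc 0 \<Longrightarrow> g xs = f (hd xs)"
    and h: "recursive n h" "\<And>xs. length xs = n \<Longrightarrow> h xs = a xs"
    using assms unfolding rec_on_def by blast
  have "recursive n (\<lambda>xs. g (map (\<lambda>h. h xs) [h]))"
    using g h by (intro recursive.comp) auto
  then show ?thesis by (rule rec_on_cong[OF rec_onI]) (simp add: g h)
qed

lemma rec_on_comp2:
  assumes "rec_on 2 (\<lambda>xs. f (xs ! 0) (xs ! 1))" "rec_on n a" "rec_on n b"
  shows "rec_on n (\<lambda>xs. f (a xs) (b xs))"
proof -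
  obtain g h k where g: "recursive (Suc (Suc 0)) g" "\<And>xs. length xs = 2 \<Longrightarrow> g xs = f (xs ! 0) (xs ! 1)"
    and h: "recursive n h" "\<And>xs. length xs = n \<Longrightarrow> h xs = a xs"
    and k: "recursive n k" "\<And>xs. length xs = n \<Longrightarrow> k xs = b xs"
    using assms unfolding rec_on_def numeral_2_eq_2 by blast
  have "recursive n (\<lambda>xs. g (map (\<lambda>h. h xs) [h, k]))"
    using g(1) h(1) k(1) by (intro recursive.comp) auto
  then show ?thesis by (rule rec_on_cong[OF rec_onI]) (simp add: g h k)
qed

lemma rec_on_prec:
  assumes "rec_on n g" "rec_on (Suc (Suc n)) h"
  shows "rec_on (Suc n) (\<lambda>xs. rec_nat (g (tl xs)) (\<lambda>k r. h (k # r # tl xs)) (hd xs))"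
proof -
  obtain g' h' where g: "recursive n g'" "\<And>xs. length xs = n \<Longrightarrow> g' xs = g xs"
    and h: "recursive (Suc (Suc n)) h'" "\<And>xs. length xs = Suc (Suc n) \<Longrightarrow> h' xs = h xs"
    using assms unfolding rec_on_def by blast
  show ?thesis
    by (rule rec_on_cong[OF rec_onI[OF recursive.prec[OF g(1) h(1)]]]) (simp add: g(2) h(2))
qed

lemma rec_on_Suc: "rec_on n a \<Longrightarrow> rec_on n (\<lambda>xs. Suc (a xs))"
  by (rule rec_on_comp1) (rule rec_onI[OF recursive.succ[unfolded One_nat_def]])

lemma rec_on_const: "rec_on n (\<lambda>xs. c)"
  by (induction c) (auto intro: rec_on_Suc rec_onI recursive.zero)

lemma rec_on_nat1:
  assumes "rec_on 2 (\<lambda>xs. h (xs ! 0) (xs ! 1))" "rec_on n a"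
  shows "rec_on n (\<lambda>xs. rec_nat c h (a xs))"
proof -
  have "rec_on (Suc 0) (\<lambda>xs. rec_nat c (\<lambda>k r. h ((k # r # tl xs) ! 0) ((k # r # tl xs) ! 1)) (hd xs))"
    using assms(1) by (intro rec_on_prec rec_on_const) (simp add: numeral_2_eq_2)
  then have "rec_on (Suc 0) (\<lambda>xs. rec_nat c h (hd xs))" by simp
  then show ?thesis using assms(2) by (rule rec_on_comp1)
qed

text \<open>One parameter is enough, since several can be packed into one by
  \<open>prod_encode\<close>.\<close>

lemma rec_on_nat2:
  assumes "rec_on (Suc 0) (\<lambda>xs. g (hd xs))" "rec_on 3 (\<lambda>xs. h (xs ! 0) (xs ! 1) (xs ! 2))"
    and "rec_on n a" "rec_on n b"
  shows "rec_on n (\<lambda>xs. rec_nat (g (b xs)) (\<lambda>k r. h k r (b xs)) (a xs))"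
proof -
  have "rec_on (Suc 1) (\<lambda>xs. rec_nat (g (hd (tl xs)))
      (\<lambda>k r. (\<lambda>ys. h (ys ! 0) (ys ! 1) (ys ! 2)) (k # r # tl xs)) (hd xs))"
    using assms(1,2) by (intro rec_on_prec) (simp_all add: numeral_3_eq_3)
  then have "rec_on 2 (\<lambda>xs. rec_nat (g (xs ! 1)) (\<lambda>k r. h k r (xs ! 1)) (xs ! 0))"
    unfolding Suc_1 by (rule rec_on_cong) (auto simp: numeral_2_eq_2 length_Suc_conv)
  then show ?thesis using assms(3,4) by (rule rec_on_comp2)
qed

lemma rec_on_hd: "rec_on (Suc 0) hd"
  by (rule rec_on_cong[OF rec_on_proj[of 0 "Suc 0"]]) (auto simp: length_Suc_conv)

lemma rec_on_plus:
  assumes "rec_on n a" "rec_on n b" shows "rec_on n (\<lambda>xs. a xs + b xs)"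
proof -
  have eq: "x + y = rec_nat y (\<lambda>k r. Suc r) x" for x y :: nat by (induction x) simp_all
  show ?thesis
    unfolding eq by (rule rec_on_nat2) (simp_all add: assms rec_on_hd rec_on_Suc rec_on_proj)
qed

lemma rec_on_minus:
  assumes "rec_on n a" "rec_on n b" shows "rec_on n (\<lambda>xs. a xs - b xs)"
proof -
  \<comment> \<open>Truncated subtraction is the \<open>y\<close>-fold predecessor, and
    \<open>rec_nat 0 (\<lambda>k r. k)\<close> is the predecessor.\<close>
  have eq: "x - y = rec_nat x (\<lambda>k r. rec_nat 0 (\<lambda>k r. k) r) y" for x y :: nat
  proof (induction y)
    case (Suc y)
    have "a - 1 = rec_nat 0 (\<lambda>k r. k) a" for a :: nat by (cases a) simp_all
    then show ?case using Suc by (metis diff_Suc_eq_diff_pred diff_commute old.nat.simps(7))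
  qed simp
  show ?thesis
    unfolding eq
    by (rule rec_on_nat2) (simp_all add: assms rec_on_hd rec_on_proj rec_on_nat1)
qed

lemma rec_on_triangle: "rec_on n a \<Longrightarrow> rec_on n (\<lambda>xs. triangle (a xs))"
proof -
  assume a: "rec_on n a"
  have eq: "triangle x = rec_nat 0 (\<lambda>k r. r + Suc k) x" for x by (induction x) simp_all
  show ?thesis
    unfolding eq by (rule rec_on_nat1)
      (simp_all add: a rec_on_plus rec_on_Suc rec_on_proj del: add_Suc_right)
qed

lemma rec_on_prod_encode:
  assumes "rec_on n a" "rec_on n b" shows "rec_on n (\<lambda>xs. prod_encode (a xs, b xs))"
  by (simp add: prod_encode_def assms rec_on_plus rec_on_triangle)

text \<open>The code \<open>prod_encode (x, y) = triangle (x + y) + x\<close> lies below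
  \<open>triangle (Suc (x + y))\<close>. Hence \<open>s\<close> recovers the diagonal
  \<open>x + y\<close> as the least \<open>k\<close> whose next triangular number exceeds the code,
  and both components follow by subtraction. This is the only place where the reductions use
  minimization.\<close>

lemma
  assumes "rec_on n a"
  shows rec_on_fst_decode: "rec_on n (\<lambda>xs. fst (prod_decode (a xs)))"
    and rec_on_snd_decode: "rec_on n (\<lambda>xs. snd (prod_decode (a xs)))"
proof -
  define T where "T z k = Suc z - triangle (Suc k)" for z k
  define s where "s z = (LEAST k. T z k = 0)" for z
  have "rec_on 2 (\<lambda>xs. T (xs ! 1) (xs ! 0))"
    unfolding T_def by (intro rec_on_minus rec_on_Suc rec_on_triangle rec_on_proj) simp_all
  then obtain g where g: "recursive (Suc 1) g" "\<And>xs. length xs = 2 \<Longrightarrow> g xs = T (xs ! 1) (xs ! 0)"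
    unfolding rec_on_def Suc_1 by blast
  have decode: "s (prod_encode (x, y)) = x + y" for x y
    unfolding s_def
  proof (rule Least_equality)
    show "T (prod_encode (x, y)) (x + y) = 0" by (simp add: T_def prod_encode_def)
    fix k assume "T (prod_encode (x, y)) k = 0"
    then have *: "triangle (x + y) + x < triangle (Suc k)" by (simp add: T_def prod_encode_def)
    show "x + y \<le> k"
    proof (rule ccontr)
      assume "\<not> x + y \<le> k"
      then have "Suc k \<le> x + y" by simp
      then have "triangle (Suc k) \<le> triangle (x + y)"
        by (rule lift_Suc_mono_le[rotated]) simp
      with * show False by simp
    qed
  qed
  have "rec_on (Suc 0) (\<lambda>xs. LEAST k. g (k # xs) = 0)"
  proof (rule rec_onI, rule recursive.mini)
    show "recursive (Suc (Suc 0)) g" using g(1) by simp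
    have "\<exists>k. T z k = 0" for z by (auto simp: T_def intro!: exI[of _ z])
    then show "\<forall>xs. length xs = Suc 0 \<longrightarrow> (\<exists>k. g (k # xs) = 0)" by (auto simp: g(2))
  qed
  then have s: "rec_on (Suc 0) (\<lambda>xs. s (hd xs))"
    by (rule rec_on_cong) (auto simp: s_def g(2) length_Suc_conv)
  have eq: "fst (prod_decode z) = z - triangle (s z)"
    "snd (prod_decode z) = s z - fst (prod_decode z)" for z
  proof -
    obtain x y where z: "z = prod_encode (x, y)" by (metis prod_decode_inverse surj_pair)
    show "fst (prod_decode z) = z - triangle (s z)" "snd (prod_decode z) = s z - fst (prod_decode z)"
      by (simp_all add: z decode) (simp add: prod_encode_def)
  qed
  show 1: "rec_on n (\<lambda>xs. fst (prod_decode (a xs)))"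
    unfolding eq(1) by (intro rec_on_minus rec_on_triangle rec_on_comp1[OF s] assms)
  show "rec_on n (\<lambda>xs. snd (prod_decode (a xs)))"
    unfolding eq(2) by (intro rec_on_minus 1 rec_on_comp1[OF s] assms)
qed

section \<open>Computable functions between coded types\<close>

text \<open>On words, lists of words and terms over the variables \<open>nat\<close>, \<open>enc\<close>
  is the coding used in the decision problems.\<close>

class coded =
  fixes enc :: "'a \<Rightarrow> nat"

instantiation nat :: coded
begin
definition enc_nat :: "nat \<Rightarrow> nat" where [simp]: "enc_nat n = n"
instance ..
end

instantiation bool :: coded
begin
definition enc_bool :: "bool \<Rightarrow> nat" where [simp]: "enc_bool b = of_bool b"
instance ..
end

instantiation prod :: (coded, coded) coded
begin
definition enc_prod :: "'a \<times> 'b \<Rightarrow> nat" where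
  "enc_prod p = prod_encode (enc (fst p), enc (snd p))"
instance ..
end

lemma enc_Pair [simp]: "enc (a, b) = prod_encode (enc a, enc b)"
  by (simp add: enc_prod_def)

instantiation list :: (coded) coded
begin
definition enc_list :: "'a list \<Rightarrow> nat" where
  "enc_list xs = list_encode (map enc xs)"
instance ..
end

lemma enc_list_simps [simp]:
  "enc ([] :: 'a :: coded list) = 0"
  "enc (x # xs) = Suc (prod_encode (enc x, enc xs))"
  by (simp_all add: enc_list_def)

instantiation lterm :: (coded) coded
begin
primrec enc_lterm :: "'a lterm \<Rightarrow> nat" where
  "enc_lterm (LVar v) = prod_encode (0, enc v)"
| "enc_lterm LOne = prod_encode (1, 0)"
| "enc_lterm (LInv t) = prod_encode (2, enc_lterm t)"
| "enc_lterm (LMult s t) = prod_encode (3, prod_encode (enc_lterm s, enc_lterm t))"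
| "enc_lterm (LMeet s t) = prod_encode (4, prod_encode (enc_lterm s, enc_lterm t))"
| "enc_lterm (LJoin s t) = prod_encode (5, prod_encode (enc_lterm s, enc_lterm t))"
instance ..
end

text \<open>The values of \<open>F\<close> at numbers that are not codes are left free, so no
  function built below has to test whether its argument is a code.\<close>

definition computable :: "('a :: coded \<Rightarrow> 'b :: coded) \<Rightarrow> bool" where
  "computable f \<longleftrightarrow> (\<exists>F. rec_on (Suc 0) (\<lambda>xs. F (hd xs)) \<and> (\<forall>x. F (enc x) = enc (f x)))"

lemma computableI:
  "rec_on (Suc 0) (\<lambda>xs. F (hd xs)) \<Longrightarrow> (\<And>x. F (enc x) = enc (f x)) \<Longrightarrow> computable f"
  unfolding computable_def by blast

lemma computableE:
  assumes "computable f"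
  obtains F where "\<And>n a. rec_on n a \<Longrightarrow> rec_on n (\<lambda>xs. F (a xs))" "\<And>x. F (enc x) = enc (f x)"
proof -
  obtain F where F: "rec_on (Suc 0) (\<lambda>xs. F (hd xs))" "\<And>x. F (enc x) = enc (f x)"
    using assms unfolding computable_def by blast
  show thesis by (rule that[OF rec_on_comp1[OF F(1)] F(2)])
qed

lemma decidable_via_iff: "decidable_via enc P \<longleftrightarrow> computable P"
proof
  assume "decidable_via enc P"
  then obtain f where f: "recursive 1 f" "\<And>p. f [enc p] = (if P p then 1 else 0)"
    unfolding decidable_via_def by blast
  show "computable P"
    by (rule computableI[where F = "\<lambda>x. f [x]"])
       (auto simp: f(2) length_Suc_conv intro!: rec_on_cong[OF rec_onI[OF f(1)[unfolded One_nat_def]]])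
next
  assume "computable P"
  then obtain F where F: "rec_on (Suc 0) (\<lambda>xs. F (hd xs))" "\<And>x. F (enc x) = enc (P x)"
    unfolding computable_def by blast
  then obtain f where "recursive 1 f" "\<And>xs. length xs = 1 \<Longrightarrow> f xs = F (hd xs)"
    unfolding rec_on_def One_nat_def by blast
  then show "decidable_via enc P"
    unfolding decidable_via_def using F(2) by (intro exI[of _ f]) simp
qed

lemma computable_id: "computable (\<lambda>x. x)"
  by (rule computableI[where F = "\<lambda>x. x"]) (simp_all add: rec_on_hd)

lemma computable_const: "computable (\<lambda>x. c)"
  by (rule computableI[where F = "\<lambda>x. enc c"]) (simp_all add: rec_on_const)

lemma computable_comp:
  assumes "computable f" "computable g" shows "computable (\<lambda>x. f (g x))"
proof -
  obtain F where F: "\<And>n a. rec_on n a \<Longrightarrow> rec_on n (\<lambda>xs. F (a xs))" "\<And>x. F (enc x) = enc (f x)"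
    by (rule computableE[OF assms(1)], rule that)
  obtain G where G: "\<And>n a. rec_on n a \<Longrightarrow> rec_on n (\<lambda>xs. G (a xs))" "\<And>x. G (enc x) = enc (g x)"
    by (rule computableE[OF assms(2)], rule that)
  show ?thesis
    by (rule computableI[where F = "\<lambda>x. F (G x)"]) (simp_all add: F G rec_on_hd)
qed

named_theorems computable_intros
declare computable_id [computable_intros] computable_const [computable_intros]

lemma computable_Pair [computable_intros]:
  assumes "computable f" "computable g" shows "computable (\<lambda>x. (f x, g x))"
proof -
  obtain F where F: "\<And>n a. rec_on n a \<Longrightarrow> rec_on n (\<lambda>xs. F (a xs))" "\<And>x. F (enc x) = enc (f x)"
    by (rule computableE[OF assms(1)], rule that)
  obtain G where G: "\<And>n a. rec_on n a \<Longrightarrow> rec_on n (\<lambda>xs. G (a xs))" "\<And>x. G (enc x) = enc (g x)"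
    by (rule computableE[OF assms(2)], rule that)
  show ?thesis
    by (rule computableI[where F = "\<lambda>x. prod_encode (F x, G x)"])
       (simp_all add: F G rec_on_hd rec_on_prod_encode)
qed

lemma computable_fst [computable_intros]: "computable f \<Longrightarrow> computable (\<lambda>x. fst (f x))"
  by (rule computable_comp[of fst], rule computableI[where F = "\<lambda>x. fst (prod_decode x)"])
     (auto simp: rec_on_hd rec_on_fst_decode)

lemma computable_snd [computable_intros]: "computable f \<Longrightarrow> computable (\<lambda>x. snd (f x))"
  by (rule computable_comp[of snd], rule computableI[where F = "\<lambda>x. snd (prod_decode x)"])
     (auto simp: rec_on_hd rec_on_snd_decode)

text \<open>The code of the pair \<open>prod_decode n\<close> is \<open>n\<close> itself.\<close>

lemma computable_prod_decode [computable_intros]: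
  "computable f \<Longrightarrow> computable (\<lambda>x. prod_decode (f x))"
  by (rule computable_comp[of prod_decode], rule computableI[where F = "\<lambda>x. x"])
     (auto simp: rec_on_hd enc_prod_def)

text \<open>As \<open>computable\<close> speaks of unary functions, a step function of several
  arguments enters as a function of one nested pair; the later rules do the same. Folds,
  \<open>drop\<close> and the recursion on terms are all reduced to this rule.\<close>

lemma computable_rec_nat [computable_intros]:
  fixes g :: "'a :: coded \<Rightarrow> 'b :: coded"
  assumes "computable m" "computable g" "computable (\<lambda>p. h (fst p) (fst (snd p)) (snd (snd p)))"
  shows "computable (\<lambda>x. rec_nat (g x) (\<lambda>k r. h k r x) (m x))"
proof -
  obtain M where M: "\<And>n a. rec_on n a \<Longrightarrow> rec_on n (\<lambda>xs. M (a xs))" "\<And>x. M (enc x) = enc (m x)"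
    by (rule computableE[OF assms(1)], rule that)
  obtain G where G: "\<And>n a. rec_on n a \<Longrightarrow> rec_on n (\<lambda>xs. G (a xs))" "\<And>x. G (enc x) = enc (g x)"
    by (rule computableE[OF assms(2)], rule that)
  obtain H where H: "\<And>n a. rec_on n a \<Longrightarrow> rec_on n (\<lambda>xs. H (a xs))"
    "\<And>p. H (enc p) = enc (h (fst p) (fst (snd p)) (snd (snd p)))"
    by (rule computableE[OF assms(3)], rule that)
  have H': "H (prod_encode (k, prod_encode (enc r, enc x))) = enc (h k r x)" for k r x
    using H(2)[of "(k, r, x)"] by simp
  show ?thesis
  proof (rule computableI[where F = "\<lambda>x. rec_nat (G x)
      (\<lambda>k r. H (prod_encode (k, prod_encode (r, x)))) (M x)"])
    show "rec_on (Suc 0) (\<lambda>xs. rec_nat (G (hd xs))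
      (\<lambda>k r. H (prod_encode (k, prod_encode (r, hd xs)))) (M (hd xs)))"
      by (intro rec_on_nat2 G M H rec_on_prod_encode rec_on_proj rec_on_hd) simp_all
    fix x
    have "rec_nat (G (enc x)) (\<lambda>k r. H (prod_encode (k, prod_encode (r, enc x)))) n =
      enc (rec_nat (g x) (\<lambda>k r. h k r x) n)" for n
      by (induction n) (simp_all add: G H')
    then show "rec_nat (G (enc x)) (\<lambda>k r. H (prod_encode (k, prod_encode (r, enc x)))) (M (enc x)) =
      enc (rec_nat (g x) (\<lambda>k r. h k r x) (m x))" by (simp add: M)
  qed
qed

lemma computable_If [computable_intros]:
  fixes f :: "'a :: coded \<Rightarrow> 'b :: coded"
  assumes "computable b" "computable f" "computable g"
  shows "computable (\<lambda>x. if b x then f x else g x)"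
proof -
  have "computable (\<lambda>x. of_bool (b x) :: nat)"
    by (rule computable_comp[OF _ assms(1)], rule computableI[where F = "\<lambda>x. x"])
       (simp_all add: rec_on_hd)
  \<comment> \<open>A recursion of length \<open>of_bool (b x)\<close>: no step leaves the else
    branch, one step yields the then branch.\<close>
  from computable_rec_nat[OF this assms(3), of "\<lambda>k r x. f x"]
  have "computable (\<lambda>x. rec_nat (g x) (\<lambda>k r. f x) (of_bool (b x)))"
    using computable_comp[OF assms(2), of "\<lambda>p. snd (snd p)"] by (simp add: computable_intros)
  also have "(\<lambda>x. rec_nat (g x) (\<lambda>k r. f x) (of_bool (b x))) = (\<lambda>x. if b x then f x else g x)"
    by auto
  finally show ?thesis .
qed

lemma computable_eq_nat [computable_intros]:
  fixes f g :: "'a :: coded \<Rightarrow> nat"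
  assumes "computable f" "computable g"
  shows "computable (\<lambda>x. f x = g x)"
proof -
  obtain F where F: "\<And>n a. rec_on n a \<Longrightarrow> rec_on n (\<lambda>xs. F (a xs))" "\<And>x. F (enc x) = enc (f x)"
    by (rule computableE[OF assms(1)], rule that)
  obtain G where G: "\<And>n a. rec_on n a \<Longrightarrow> rec_on n (\<lambda>xs. G (a xs))" "\<And>x. G (enc x) = enc (g x)"
    by (rule computableE[OF assms(2)], rule that)
  show ?thesis
    \<comment> \<open>With truncated subtraction the sum of the two differences is the distance,
      which vanishes exactly at equal arguments.\<close>
    by (rule computableI[where F = "\<lambda>x. 1 - ((F x - G x) + (G x - F x))"])
       (auto simp: F G rec_on_minus rec_on_plus rec_on_const rec_on_hd)
qed

text \<open>The step function ignores the recursive value, so \<open>rec_nat\<close> acts as a case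
  distinction between zero and successor. At the code \<open>Suc k\<close> of a nonempty list,
  \<open>k\<close> is the code of the pair of head and tail.\<close>

lemma computable_case_list [computable_intros]:
  fixes g :: "'a :: coded \<Rightarrow> 'b :: coded" and l :: "'a \<Rightarrow> 'c :: coded list"
  assumes "computable l" "computable g" "computable (\<lambda>p. h (fst p) (fst (snd p)) (snd (snd p)))"
  shows "computable (\<lambda>x. case l x of [] \<Rightarrow> g x | y # ys \<Rightarrow> h y ys x)"
proof -
  obtain L where L: "\<And>n a. rec_on n a \<Longrightarrow> rec_on n (\<lambda>xs. L (a xs))" "\<And>x. L (enc x) = enc (l x)"
    by (rule computableE[OF assms(1)], rule that)
  obtain G where G: "\<And>n a. rec_on n a \<Longrightarrow> rec_on n (\<lambda>xs. G (a xs))" "\<And>x. G (enc x) = enc (g x)"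
    by (rule computableE[OF assms(2)], rule that)
  obtain H where H: "\<And>n a. rec_on n a \<Longrightarrow> rec_on n (\<lambda>xs. H (a xs))"
    "\<And>p. H (enc p) = enc (h (fst p) (fst (snd p)) (snd (snd p)))"
    by (rule computableE[OF assms(3)], rule that)
  have H': "H (prod_encode (enc y, prod_encode (enc ys, enc x))) = enc (h y ys x)" for y ys x
    using H(2)[of "(y, ys, x)"] by simp
  show ?thesis
  proof (rule computableI[where F = "\<lambda>x. rec_nat (G x) (\<lambda>k r. H (prod_encode (fst (prod_decode k),
      prod_encode (snd (prod_decode k), x)))) (L x)"])
    show "rec_on (Suc 0) (\<lambda>xs. rec_nat (G (hd xs)) (\<lambda>k r. H (prod_encode (fst (prod_decode k),
      prod_encode (snd (prod_decode k), hd xs)))) (L (hd xs)))"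
      by (intro rec_on_nat2 G L H rec_on_prod_encode rec_on_fst_decode rec_on_snd_decode
          rec_on_proj rec_on_hd) simp_all
  qed (simp add: L G H' split: list.split)
qed

lemma computable_Cons [computable_intros]:
  "computable f \<Longrightarrow> computable g \<Longrightarrow> computable (\<lambda>x. f x # g x)"
  by (rule computable_comp[of "\<lambda>p. fst p # snd p" "\<lambda>x. (f x, g x)", simplified],
      rule computableI[where F = "\<lambda>x. Suc x"])
     (auto simp: rec_on_hd rec_on_Suc enc_prod_def computable_Pair)

lemma length_le_enc: "length xs \<le> enc xs"
  by (induction xs) (auto intro: order_trans[OF _ le_prod_encode_2])

lemma computable_fold [computable_intros]:
  fixes g :: "'a :: coded \<Rightarrow> 'b :: coded" and l :: "'a \<Rightarrow> 'c :: coded list"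
  assumes "computable l" "computable g" "computable (\<lambda>p. h (fst p) (fst (snd p)) (snd (snd p)))"
  shows "computable (\<lambda>x. fold (\<lambda>y r. h y r x) (l x) (g x))"
proof -
  \<comment> \<open>The code of a list bounds its length, so iterating this step as many times consumes it.\<close>
  define step :: "'a \<Rightarrow> 'c list \<times> 'b \<Rightarrow> 'c list \<times> 'b"
    where "step x p = (case fst p of [] \<Rightarrow> ([], snd p) | y # ys \<Rightarrow> (ys, h y (snd p) x))" for x p
  have step_simps: "step x ([], r) = ([], r)" "step x (y # ys, r) = (ys, h y r x)" for x y ys r
    by (simp_all add: step_def)
  have step: "rec_nat (ys, r) (\<lambda>k. step x) n = ([], fold (\<lambda>y r. h y r x) ys r)"
    if "length ys \<le> n" for n ys r x
    using that
  proof (induction n arbitrary: ys r)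
    case (Suc n)
    \<comment> \<open>\<open>rec_nat\<close> peels off its last step on the outside; since
      \<open>step x\<close> does not depend on the counter, a step can be peeled off on the inside
      instead, where the first list element is consumed.\<close>
    have shift: "rec_nat p (\<lambda>k. step x) (Suc n) = rec_nat (step x p) (\<lambda>k. step x) n" for p
      by (induction n) simp_all
    have "rec_nat (ys, r) (\<lambda>k. step x) (Suc n) = rec_nat (step x (ys, r)) (\<lambda>k. step x) n"
      by (rule shift)
    also have "\<dots> = ([], fold (\<lambda>y r. h y r x) ys r)"
      using Suc by (cases ys) (simp_all add: step_simps del: old.nat.simps(7))
    finally show ?case .
  qed simp
  have "computable (\<lambda>x. enc (l x))"
    by (rule computable_comp[OF _ assms(1)], rule computableI[where F = "\<lambda>x. x"])
       (simp_all add: rec_on_hd)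
  \<comment> \<open>Here \<open>p\<close> is the tuple \<open>(y, ys, k, q, x)\<close> that the
    rules for the list case inside \<open>rec_nat\<close> build up, with \<open>q\<close> the
    current state.\<close>
  moreover have "computable (\<lambda>p. h (fst p) (snd (fst (snd (snd (snd p))))) (snd (snd (snd (snd p)))))"
    using computable_comp[OF assms(3),
      of "\<lambda>p. (fst p, snd (fst (snd (snd (snd p)))), snd (snd (snd (snd p))))"]
    by (simp add: computable_intros)
  ultimately have "computable (\<lambda>x. snd (rec_nat (l x, g x) (\<lambda>k r. step x r) (enc (l x))))"
    unfolding step_def by (intro computable_intros assms)
  then show ?thesis by (simp add: step length_le_enc)
qed

lemma computable_rev [computable_intros]: "computable f \<Longrightarrow> computable (\<lambda>x. rev (f x))"
  unfolding rev_conv_fold by (intro computable_intros)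

lemma computable_foldr [computable_intros]:
  fixes g :: "'a :: coded \<Rightarrow> 'b :: coded" and l :: "'a \<Rightarrow> 'c :: coded list"
  assumes "computable l" "computable g" "computable (\<lambda>p. h (fst p) (fst (snd p)) (snd (snd p)))"
  shows "computable (\<lambda>x. foldr (\<lambda>y r. h y r x) (l x) (g x))"
  unfolding foldr_conv_fold by (intro computable_intros assms)

lemma computable_append [computable_intros]:
  assumes "computable f" "computable g" shows "computable (\<lambda>x. f x @ g x)"
proof -
  have eq: "us @ vs = foldr (\<lambda>y r. y # r) us vs" for us vs :: "'b list" by (induction us) simp_all
  show ?thesis unfolding eq by (intro computable_intros assms)
qed

lemma computable_map [computable_intros]:
  assumes "computable l" "computable (\<lambda>p. h (fst p) (snd p))"
  shows "computable (\<lambda>x. map (\<lambda>y. h y x) (l x))"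
proof -
  have "computable (\<lambda>p. h (fst p) (snd (snd p)))"
    using computable_comp[OF assms(2), of "\<lambda>p. (fst p, snd (snd p))"] by (simp add: computable_intros)
  then have "computable (\<lambda>x. foldr (\<lambda>y r. h y x # r) (l x) [])"
    by (intro computable_intros assms)
  moreover have "foldr (\<lambda>y r. h y x # r) ys [] = map (\<lambda>y. h y x) ys" for x ys
    by (induction ys) simp_all
  ultimately show ?thesis by simp
qed

lemma computable_concat [computable_intros]:
  "computable f \<Longrightarrow> computable (\<lambda>x. concat (f x))"
  unfolding concat_conv_foldr by (rule computable_comp) (intro computable_intros)

lemma computable_list_all [computable_intros]:
  assumes "computable l" "computable (\<lambda>p. h (fst p) (snd p))"
  shows "computable (\<lambda>x. list_all (\<lambda>y. h y x) (l x))"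
proof -
  have "computable (\<lambda>p. h (fst p) (snd (snd p)))"
    using computable_comp[OF assms(2), of "\<lambda>p. (fst p, snd (snd p))"] by (simp add: computable_intros)
  then have "computable (\<lambda>x. foldr (\<lambda>y r. if h y x then r else False) (l x) True)"
    by (intro computable_intros assms)
  moreover have "foldr (\<lambda>y r. if h y x then r else False) ys True = list_all (\<lambda>y. h y x) ys" for x ys
    by (induction ys) simp_all
  ultimately show ?thesis by simp
qed

lemma computable_nth_default:
  assumes "computable i" "computable l"
  shows "computable (\<lambda>x. case drop (i x) (l x) of [] \<Rightarrow> d | y # ys \<Rightarrow> y)"
proof -
  have eq: "drop n xs = rec_nat xs (\<lambda>k r. case r of [] \<Rightarrow> [] | y # ys \<Rightarrow> ys) n" for n and xs :: "'b list"
  proof (induction n)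
    case (Suc n)
    have "drop (Suc n) xs = tl (drop n xs)" by (simp add: drop_Suc tl_drop)
    then show ?case by (simp add: Suc tl_def)
  qed simp
  show ?thesis unfolding eq by (intro computable_intros assms)
qed

section \<open>Computability on terms\<close>

lemma computable_LVar [computable_intros]: "computable f \<Longrightarrow> computable (\<lambda>x. LVar (f x))"
  by (rule computable_comp[of LVar], rule computableI[where F = "\<lambda>n. prod_encode (0, n)"])
     (auto simp: rec_on_hd rec_on_prod_encode rec_on_const)

lemma computable_LInv [computable_intros]: "computable f \<Longrightarrow> computable (\<lambda>x. LInv (f x))"
  by (rule computable_comp[of LInv], rule computableI[where F = "\<lambda>n. prod_encode (2, n)"])
     (auto simp: rec_on_hd rec_on_prod_encode rec_on_const)

lemma
  assumes "computable f" "computable g"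
  shows computable_LMult [computable_intros]: "computable (\<lambda>x. LMult (f x) (g x))"
    and computable_LMeet [computable_intros]: "computable (\<lambda>x. LMeet (f x) (g x))"
    and computable_LJoin [computable_intros]: "computable (\<lambda>x. LJoin (f x) (g x))"
proof -
  have *: "computable (\<lambda>x. C (f x) (g x))"
    if "\<And>s t. enc (C s t) = prod_encode (k, prod_encode (enc s, enc t))"
    for C :: "'b lterm \<Rightarrow> 'b lterm \<Rightarrow> 'b lterm" and k
  proof -
    have "computable (\<lambda>p. C (fst p) (snd p))"
      by (rule computableI[where F = "\<lambda>n. prod_encode (k, n)"])
         (simp_all add: that enc_prod_def rec_on_hd rec_on_prod_encode rec_on_const)
    from computable_comp[OF this computable_Pair[OF assms]] show ?thesis by simp
  qed
  show "computable (\<lambda>x. LMult (f x) (g x))" "computable (\<lambda>x. LMeet (f x) (g x))"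
    "computable (\<lambda>x. LJoin (f x) (g x))"
    by (rule *, simp)+
qed

lemma computable_lterm_rec:
  fixes f :: "nat lterm \<Rightarrow> 'b :: coded"
  assumes V: "computable V" and I: "computable I" and P: "computable P"
    and M: "computable M" and J: "computable J"
    and f: "\<And>v. f (LVar v) = V v" "f LOne = c" "\<And>t. f (LInv t) = I (f t)"
      "\<And>s t. f (LMult s t) = P (f s, f t)" "\<And>s t. f (LMeet s t) = M (f s, f t)"
      "\<And>s t. f (LJoin s t) = J (f s, f t)"
  shows "computable f"
proof -
  define look where "look j tab = (case drop j tab of [] \<Rightarrow> c | y # ys \<Rightarrow> y)" for j and tab :: "'b list"
  define H where "H k tab =
    (let tag = fst (prod_decode k); r = snd (prod_decode k);
       p = (look (fst (prod_decode r)) tab, look (snd (prod_decode r)) tab)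
     in if tag = 0 then V r else if tag = 1 then c else if tag = 2 then I (look r tab)
        else if tag = 3 then P p else if tag = 4 then M p else J p)" for k tab
  \<comment> \<open>course-of-values recursion: \<open>tab n\<close> lists the values at the codes below \<open>n\<close>\<close>
  define tab where "tab n = rec_nat [] (\<lambda>k tab. tab @ [H k tab]) n" for n
  define F where "F k = H k (tab k)" for k
  have tab: "tab n = map F [0..<n]" for n
    by (induction n) (simp_all add: tab_def F_def)
  have look: "look j (tab k) = F j" if "j < k" for j k
  proof -
    have "drop j (tab k) = F j # map F [Suc j..<k]"
      unfolding tab drop_map drop_upt using that by (simp add: upt_conv_Cons)
    then show ?thesis by (simp add: look_def)
  qed
  \<comment> \<open>Looking up subterms in the table needs their codes to be strictly smaller. The
    constructors with subterms have positive tags, which gives strictness; with tag 0 it fails, as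
    \<open>prod_encode (0, 0) = 0\<close>.\<close>
  have lt: "n < prod_encode (Suc k, n)" for k n
    by (simp add: prod_encode_def)
  have lt2: "m < prod_encode (Suc k, prod_encode (m, n))"
    "n < prod_encode (Suc k, prod_encode (m, n))" for k m n
    using lt[of "prod_encode (m, n)" k] le_prod_encode_1[of m n] le_prod_encode_2[of n m] by linarith+
  have lts: "n < prod_encode (2, n)" "m < prod_encode (3, prod_encode (m, n))"
    "n < prod_encode (3, prod_encode (m, n))" "m < prod_encode (4, prod_encode (m, n))"
    "n < prod_encode (4, prod_encode (m, n))" "m < prod_encode (5, prod_encode (m, n))"
    "n < prod_encode (5, prod_encode (m, n))" for m n
    using lt[of n 1] lt2[of m 2 n] lt2[of n 2 m] lt2[of m 3 n] lt2[of n 3 m]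
      lt2[of m 4 n] lt2[of n 4 m]
    by (simp_all add: eval_nat_numeral)
  have F: "F (enc t) = f t" for t
  proof (induction t)
    case (LInv t)
    then show ?case
      using look[OF lts(1)] by (subst F_def) (simp add: H_def f Let_def)
  next
    case (LMult s t)
    then show ?case
      using look[OF lts(2)] look[OF lts(3)] by (subst F_def) (simp add: H_def f Let_def)
  next
    case (LMeet s t)
    then show ?case
      using look[OF lts(4)] look[OF lts(5)] by (subst F_def) (simp add: H_def f Let_def)
  next
    case (LJoin s t)
    then show ?case
      using look[OF lts(6)] look[OF lts(7)] by (subst F_def) (simp add: H_def f Let_def)
  qed (simp_all add: F_def H_def f Let_def)
  have e: "computable (\<lambda>t :: nat lterm. enc t)"
    by (rule computableI[where F = "\<lambda>n. n"]) (simp_all add: rec_on_hd)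
  have look_comp: "computable (\<lambda>x. look (i x) (l x))" if "computable i" "computable l"
    for i and l :: "'c :: coded \<Rightarrow> 'b list"
    unfolding look_def using that by (rule computable_nth_default)
  have H_comp: "computable (\<lambda>x. H (k x) (l x))" if "computable k" "computable l"
    for k and l :: "'c :: coded \<Rightarrow> 'b list"
    unfolding H_def Let_def
    by (intro computable_intros look_comp that computable_comp[OF V] computable_comp[OF I]
        computable_comp[OF P] computable_comp[OF M] computable_comp[OF J])
  have "computable (\<lambda>t :: nat lterm. H (enc t) (tab (enc t)))"
    unfolding tab_def by (intro computable_intros H_comp e)
  then show ?thesis by (simp add: F flip: F_def)
qed

text \<open>Multiplication distributes over meets and joins on both sides. So the product of two
  meets of joins is the meet, over the pairs \<open>A\<close>, \<open>B\<close>, of the joins of all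
  \<open>u @ v\<close>. In the same way \<open>join_nf\<close> is distributivity of join over
  meet.\<close>

definition product_nf :: "'x word list list \<Rightarrow> 'x word list list \<Rightarrow> 'x word list list" where
  "product_nf a b =
     concat (map (\<lambda>A. map (\<lambda>B. concat (map (\<lambda>u. map (\<lambda>v. u @ v) B) A)) b) a)"

definition join_nf :: "'x word list list \<Rightarrow> 'x word list list \<Rightarrow> 'x word list list" where
  "join_nf a b = concat (map (\<lambda>A. map (\<lambda>B. A @ B) b) a)"

text \<open>A list of lists of words stands for the meet of the joins of the words.  The inverse of a
  meet of joins is no meet of joins, so we compute the normal forms of a term and of its inverse
  together.\<close>

primrec nf :: "'x lterm \<Rightarrow> 'x word list list \<times> 'x word list list" where
  "nf (LVar x) = ([[[(x, True)]]], [[[(x, False)]]])"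
| "nf LOne = ([[[]]], [[[]]])"
| "nf (LInv t) = (snd (nf t), fst (nf t))"
| "nf (LMult s t) =
     (product_nf (fst (nf s)) (fst (nf t)), product_nf (snd (nf t)) (snd (nf s)))"
| "nf (LMeet s t) = (fst (nf s) @ fst (nf t), join_nf (snd (nf s)) (snd (nf t)))"
| "nf (LJoin s t) = (join_nf (fst (nf s)) (fst (nf t)), snd (nf s) @ snd (nf t))"

lemma computable_nf: "computable (nf :: nat lterm \<Rightarrow> _)"
proof (rule computable_lterm_rec)
  show "computable (\<lambda>x :: nat. ([[[(x, True)]]], [[[(x, False)]]]))"
    by (intro computable_intros)
  show "computable (\<lambda>p :: nat word list list \<times> nat word list list. (snd p, fst p))"
    by (intro computable_intros)
  show "computable (\<lambda>p :: (nat word list list \<times> nat word list list) \<times> _ \<times> _.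
      (product_nf (fst (fst p)) (fst (snd p)), product_nf (snd (snd p)) (snd (fst p))))"
    unfolding product_nf_def by (intro computable_intros)
  show "computable (\<lambda>p :: (nat word list list \<times> nat word list list) \<times> _ \<times> _.
      (fst (fst p) @ fst (snd p), join_nf (snd (fst p)) (snd (snd p))))"
    unfolding join_nf_def by (intro computable_intros)
  show "computable (\<lambda>p :: (nat word list list \<times> nat word list list) \<times> _ \<times> _.
      (join_nf (fst (fst p)) (fst (snd p)), snd (fst p) @ snd (snd p)))"
    unfolding join_nf_def by (intro computable_intros)
qed simp_all

lemma computable_word_term [computable_intros]:
  "computable f \<Longrightarrow> computable (\<lambda>x. word_term (f x))"
  unfolding word_term_def case_prod_unfold by (intro computable_intros)

text \<open>Head and tail are given separately because \<open>big_join\<close> takes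
  \<open>hd\<close> of its list, which is unspecified at the empty list.\<close>

lemma computable_big_join_Cons:
  "computable (\<lambda>p. big_join (map word_term (fst p # snd p)))"
  unfolding big_join_def list.map list.sel foldl_conv_fold by (intro computable_intros)

lemma enc_nat_word: "enc w = word_code w"
proof -
  have "enc = (\<lambda>(x :: nat, b). prod_encode (x, of_bool b))" by auto
  then show ?thesis by (simp add: enc_list_def word_code_def)
qed

lemma enc_nat_lterm: "enc t = lterm_code t"
  by (induction t) simp_all


section \<open>Totally ordered groups\<close>

context l_group
begin

lemma meet_idem: "x \<in> carrier L \<Longrightarrow> lmeet L x x = x"
  by (metis join_meet_absorb meet_join_absorb meet_closed)

lemma lle_refl: "x \<in> carrier L \<Longrightarrow> lle L x x"
  by (simp add: lle_def meet_idem)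

lemma lle_antisym: "\<lbrakk>x \<in> carrier L; y \<in> carrier L; lle L x y; lle L y x\<rbrakk> \<Longrightarrow> x = y"
  by (metis lle_def meet_commute)

lemma lle_trans: "\<lbrakk>x \<in> carrier L; y \<in> carrier L; z \<in> carrier L; lle L x y; lle L y z\<rbrakk> \<Longrightarrow> lle L x z"
  by (metis lle_def meet_assoc)

lemma lle_iff_join: "\<lbrakk>x \<in> carrier L; y \<in> carrier L\<rbrakk> \<Longrightarrow> lle L x y \<longleftrightarrow> ljoin L x y = y"
  by (metis join_commute join_meet_absorb lle_def meet_commute meet_join_absorb)

lemma mult_lle_mono:
  assumes "x \<in> carrier L" "x' \<in> carrier L" "y \<in> carrier L" "y' \<in> carrier L" "lle L x x'" "lle L y y'"
  shows "lle L (x \<otimes> y) (x' \<otimes> y')"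
proof (rule lle_trans)
  show "lle L (x \<otimes> y) (x' \<otimes> y)" using translate[of x x' \<one> y] assms by simp
  show "lle L (x' \<otimes> y) (x' \<otimes> y')" using translate[of y y' x' \<one>] assms by simp
qed (use assms in simp_all)

lemma one_lle_inv_mult_iff:
  assumes "x \<in> carrier L" "y \<in> carrier L"
  shows "lle L \<one> (inv x \<otimes> y) \<longleftrightarrow> lle L x y"
proof
  assume "lle L \<one> (inv x \<otimes> y)"
  then show "lle L x y" using translate[of \<one> "inv x \<otimes> y" x \<one>] assms by (simp flip: m_assoc)
next
  assume "lle L x y"
  then show "lle L \<one> (inv x \<otimes> y)" using translate[of x y "inv x" \<one>] assms by simp
qed

lemma inv_lle_iff:
  assumes "x \<in> carrier L" "y \<in> carrier L" shows "lle L (inv x) (inv y) \<longleftrightarrow> lle L y x"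
proof -
  have "lle L (inv u) (inv v)" if "u \<in> carrier L" "v \<in> carrier L" "lle L v u" for u v
  proof -
    have "inv u \<otimes> u \<otimes> inv v = inv v" "inv u \<otimes> v \<otimes> inv v = inv u"
      using that by (simp_all add: m_assoc)
    then show ?thesis using translate[OF that(2,1) _ _ that(3), of "inv u" "inv v"] that by simp
  qed
  from this[of x y] this[of "inv y" "inv x"] show ?thesis using assms by auto
qed

end

context ordered_l_group
begin

lemma join_cases:
  assumes "x \<in> carrier L" "y \<in> carrier L"
  obtains "ljoin L x y = y" "lle L x y" | "ljoin L x y = x" "lle L y x"
  using assms total by (metis join_commute lle_iff_join)

lemma meet_cases:
  assumes "x \<in> carrier L" "y \<in> carrier L"
  obtains "lmeet L x y = x" "lle L x y" | "lmeet L x y = y" "lle L y x"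
  using assms total by (metis meet_commute lle_def)

text \<open>In a total order the join is one of its two arguments. In a general l-group the
  left-to-right direction fails, which is why inequalities are first moved to totally ordered
  groups.\<close>

lemma lle_join_iff:
  assumes "x \<in> carrier L" "y \<in> carrier L" "z \<in> carrier L"
  shows "lle L z (ljoin L x y) \<longleftrightarrow> lle L z x \<or> lle L z y"
  using join_cases[OF assms(1,2)] lle_trans assms by metis


lemma inv_join:
  assumes "x \<in> carrier L" "y \<in> carrier L" shows "inv (ljoin L x y) = lmeet L (inv x) (inv y)"
proof -
  have "lle L (inv x) (inv y) \<longleftrightarrow> lle L y x" "lle L (inv y) (inv x) \<longleftrightarrow> lle L x y"
    using assms by (simp_all add: inv_lle_iff)
  then show ?thesis
    using assms by (cases rule: join_cases[OF assms])
      (simp_all add: lle_def meet_commute[of "inv x" "inv y"])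
qed

lemma inv_meet:
  assumes "x \<in> carrier L" "y \<in> carrier L" shows "inv (lmeet L x y) = ljoin L (inv x) (inv y)"
  using inv_join[of "inv x" "inv y"] assms by (metis inv_closed inv_inv join_closed)

end

lemma word_term_simps [simp]:
  "word_term [] = LOne"
  "word_term (l # w) = LMult (if snd l then LVar (fst l) else LInv (LVar (fst l))) (word_term w)"
  by (simp_all add: word_term_def case_prod_unfold)

lemma leval_word_term: "leval L a (word_term w) = word_eval L a w"
  by (induction w) auto

lemma lle_big_join_iff:
  assumes "ordered_l_group L" "a \<in> UNIV \<rightarrow> carrier L" "z \<in> carrier L" "ts \<noteq> []"
  shows "lle L z (leval L a (big_join ts)) \<longleftrightarrow> (\<exists>t \<in> set ts. lle L z (leval L a t))"
proof -
  interpret ordered_l_group L by fact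
  note cl = leval_closed[OF l_group_axioms assms(2)]
  have "lle L z (leval L a (foldl LJoin t us)) \<longleftrightarrow>
      (\<exists>u \<in> insert t (set us). lle L z (leval L a u))" for t us
    by (induction us arbitrary: t) (auto simp: lle_join_iff cl assms(3))
  then show ?thesis using assms(4) by (cases ts) (simp_all add: big_join_def)
qed

section \<open>Reduction to totally ordered groups\<close>

lemma representable_ordered_l_group:
  fixes L :: "'a lgrp"
  assumes "ordered_l_group L" shows "representable L"
  by (rule representable_if_separated[where I = "{()}" and M = "\<lambda>_. L" and f = "\<lambda>_ x. x"])
     (use assms in \<open>auto simp: lhom_def hom_def ordered_l_group_def\<close>)

lemma satisfies_hom_image:
  fixes G :: "('a, 'm) monoid_scheme" and H :: "('b, 'n) monoid_scheme"
  assumes "group G" "group H" "h \<in> hom G H" "h ` carrier G = carrier H" "satisfies G \<Sigma>"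
  shows "satisfies H \<Sigma>"
  unfolding satisfies_def
proof (intro ballI, clarify)
  fix s t and a :: "nat \<Rightarrow> 'b" assume st: "(s, t) \<in> \<Sigma>" and a: "a \<in> UNIV \<rightarrow> carrier H"
  have "\<forall>v. \<exists>x \<in> carrier G. a v = h x" using a assms(4) by blast
  then obtain b where b: "\<And>v. b v \<in> carrier G" "\<And>v. a v = h (b v)" by metis
  then have b': "b \<in> UNIV \<rightarrow> carrier G" "a = h \<circ> b" by auto
  have "geval G b s = geval G b t" using assms(5) st b'(1) unfolding satisfies_def by blast
  then show "geval H a s = geval H a t"
    by (simp add: b'(2) flip: geval_hom[OF assms(1-3) b'(1)])
qed

text \<open>The projections of a subdirect product separate points, so an equation that fails in the
  product fails in a factor. The factors satisfy \<open>\<Sigma>\<close> as the projections are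
  onto. Conversely an ordered group is a subdirect product with itself as the only factor.\<close>

lemma Rep_eq_iff_ordered:
  "Rep_eq TYPE('l) \<Sigma> s t \<longleftrightarrow> (\<forall>(L :: 'l lgrp) a. ordered_l_group L \<longrightarrow> satisfies L \<Sigma> \<longrightarrow>
     a \<in> UNIV \<rightarrow> carrier L \<longrightarrow> leval L a s = leval L a t)" (is "_ \<longleftrightarrow> ?R")
proof
  assume "Rep_eq TYPE('l) \<Sigma> s t"
  then show ?R using representable_ordered_l_group unfolding Rep_eq_def Rep_def by blast
next
  assume R: ?R
  show "Rep_eq TYPE('l) \<Sigma> s t"
    unfolding Rep_eq_def
  proof (intro ballI)
    fix L :: "'l lgrp" and a :: "'a \<Rightarrow> 'l"
    assume "L \<in> Rep \<Sigma>" and a: "a \<in> UNIV \<rightarrow> carrier L"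
    then obtain I :: "'l set" and M :: "'l \<Rightarrow> 'l lgrp" and \<phi>
      where L: "l_group L" and sat: "satisfies L \<Sigma>"
      and M: "\<And>i. i \<in> I \<Longrightarrow> ordered_l_group (M i)" and \<phi>: "subdirect_embedding L I M \<phi>"
      unfolding Rep_def representable_def by blast
    show "leval L a s = leval L a t"
    proof (rule subdirect_embedding_separates[OF \<phi>])
      fix i assume i: "i \<in> I"
      define h where "h x = \<phi> x i" for x
      have h: "h \<in> lhom L (M i)"
        using subdirect_embedding_component[OF \<phi> i] by (simp add: h_def[abs_def])
      have Mi: "l_group (M i)" using M[OF i] by (simp add: ordered_l_group_def)
      have "h ` carrier L = carrier (M i)"
        using \<phi> i by (simp add: subdirect_embedding_def h_def)
      then have "satisfies (M i) \<Sigma>"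
        using satisfies_hom_image[OF _ _ lhom_hom[OF h] _ sat] L Mi by (simp add: l_group_def)
      moreover have "h \<circ> a \<in> UNIV \<rightarrow> carrier (M i)" using a h by (auto simp: lhom_def hom_def)
      ultimately have "leval (M i) (h \<circ> a) s = leval (M i) (h \<circ> a) t" using R M[OF i] by blast
      then show "\<phi> (leval L a s) i = \<phi> (leval L a t) i"
        by (simp add: leval_hom[OF L Mi h a, symmetric] flip: h_def)
    qed (rule leval_closed[OF L a])+
  qed
qed

lemma Rep_eq_types:
  assumes "infinite (UNIV :: 'l set)" "infinite (UNIV :: 'm set)"
  shows "Rep_eq TYPE('l) \<Sigma> s t \<longleftrightarrow> Rep_eq TYPE('m) \<Sigma> s t"
  using Rep_eq_all_types[OF assms(1)] Rep_eq_all_types[OF assms(2)] by (rule iffI)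

text \<open>The inequality e \<le> w_1 v ... v w_n with its join read as a disjunction. Unlike
  \<open>big_join\<close>, this form makes sense for the empty list too, and the words may be
  unreduced.\<close>

definition ordered_valid :: "'l itself \<Rightarrow> group_eqs \<Rightarrow> 'x word list \<Rightarrow> bool" where
  "ordered_valid T \<Sigma> ws \<longleftrightarrow> (\<forall>(L :: 'l lgrp) a. ordered_l_group L \<longrightarrow> satisfies L \<Sigma> \<longrightarrow>
     a \<in> UNIV \<rightarrow> carrier L \<longrightarrow> (\<exists>w \<in> set ws. lle L \<one>\<^bsub>L\<^esub> (word_eval L a w)))"

lemma Rep_le_big_join_iff:
  assumes "ws \<noteq> []"
  shows "Rep_le TYPE('l) \<Sigma> LOne (big_join (map word_term ws)) \<longleftrightarrow> ordered_valid TYPE('l) \<Sigma> ws"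
proof -
  have "leval L a (LMeet LOne (big_join (map word_term ws))) = leval L a LOne \<longleftrightarrow>
      (\<exists>w \<in> set ws. lle L \<one>\<^bsub>L\<^esub> (word_eval L a w))"
    if L: "ordered_l_group L" and a: "a \<in> UNIV \<rightarrow> carrier L" for L :: "'l lgrp" and a
  proof -
    interpret ordered_l_group L by fact
    show ?thesis
      using lle_big_join_iff[OF L a one_closed, of "map word_term ws"] assms
      by (simp add: leval_word_term) (simp add: lle_def)
  qed
  then show ?thesis
    unfolding Rep_le_def Rep_eq_iff_ordered ordered_valid_def by blast
qed

section \<open>Normal subsemigroups and orders\<close>

lemma free_group_Cons:
  assumes "l # w \<in> carrier (free_group X)"
  shows "[l] \<in> carrier (free_group X)" "w \<in> carrier (free_group X)"
    "l # w = [l] \<otimes>\<^bsub>free_group X\<^esub> w"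
  using assms by (auto simp: free_group_def reduced_def reduce_reduced[unfolded reduced_def]
      successively_Cons)

lemma hom_free_group_eq_word_eval:
  assumes "group G" "k \<in> hom (free_group X) G" "w \<in> carrier (free_group X)"
    and eq: "\<And>x. x \<in> X \<Longrightarrow> k [(x, True)] = f x"
  shows "k w = word_eval G f w"
proof -
  let ?F = "free_group X"
  interpret F: group ?F by (rule group_free_group)
  interpret group_hom ?F G k
    using assms(1,2) F.is_group by (simp add: group_hom_def group_hom_axioms_def)
  have letter: "k [(x, b)] = (if b then f x else inv\<^bsub>G\<^esub> f x)" if x: "x \<in> X" for x b
  proof (cases b)
    case False
    have "[(x, False)] \<otimes>\<^bsub>?F\<^esub> [(x, True)] = \<one>\<^bsub>?F\<^esub>"
      by (simp add: free_group_def reduce_def opp_def)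
    then have "[(x, False)] = inv\<^bsub>?F\<^esub> [(x, True)]"
      using x by (metis F.inv_equality generator_in_free_group)
    then show ?thesis using False eq[OF x] generator_in_free_group[OF x] by simp
  qed (simp add: eq x)
  show ?thesis
    using assms(3)
  proof (induction w)
    case Nil
    then show ?case using hom_one by (simp add: free_group_def)
  next
    case (Cons l w)
    obtain x b where l: "l = (x, b)" by force
    have "x \<in> X" using Cons.prems by (simp add: free_group_def l)
    then show ?case
      using free_group_Cons(1,2)[OF Cons.prems] Cons.IH letter[of x b]
      by (subst free_group_Cons(3)[OF Cons.prems]) (simp add: l)
  qed
qed

text \<open>Instances of the Normal Identity Problem are arbitrary words, while elements of the free
  group are reduced ones.\<close>

lemma word_eval_reduce:
  assumes "group G" "a \<in> UNIV \<rightarrow> carrier G"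
  shows "word_eval G a (reduce w) = word_eval G a w"
proof (induction w)
  case (Cons l w)
  let ?F = "free_group UNIV"
  interpret group G by fact
  have cl: "[l] \<in> carrier ?F" "reduce w \<in> carrier ?F"
    using reduced_reduce[of w] by (simp_all add: free_group_def reduced_def)
  have "reduce (l # w) = [l] \<otimes>\<^bsub>?F\<^esub> reduce w"
    using reduce_append_reduce[of "[l]" w] by (simp add: free_group_def)
  then have "word_eval G a (reduce (l # w)) = word_eval G a [l] \<otimes>\<^bsub>G\<^esub> word_eval G a (reduce w)"
    using word_eval_hom[OF assms] cl by (simp add: hom_def)
  also have "\<dots> = word_eval G a (l # w)"
    using assms(2) by (cases l) (simp add: Cons Pi_iff)
  finally show ?case .
qed (simp add: reduce_def)

lemma rel_free_group_hom_words:
  assumes "group G" "satisfies G \<Sigma>" "a \<in> X \<rightarrow> carrier G"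
  obtains h where "h \<in> hom (rel_free_group \<Sigma> X) G"
    "\<And>w. w \<in> carrier (free_group X) \<Longrightarrow> h (rel_class \<Sigma> X w) = word_eval G a w"
proof -
  obtain h where h: "h \<in> hom (rel_free_group \<Sigma> X) G" "\<And>x. x \<in> X \<Longrightarrow> h (rel_class \<Sigma> X [(x, True)]) = a x"
    using rel_free_group_universal[OF assms] by blast
  have "h \<circ> rel_class \<Sigma> X \<in> hom (free_group X) G"
    using rel_class_hom h(1) by (rule hom_compose)
  then have "(h \<circ> rel_class \<Sigma> X) w = word_eval G a w" if "w \<in> carrier (free_group X)" for w
    using that by (rule hom_free_group_eq_word_eval[OF assms(1)]) (simp add: h(2))
  then show thesis using that[OF h(1)] by simp
qed

lemma normal_subsemigroup_closed:
  assumes "group G" "S \<subseteq> carrier G" "x \<in> normal_subsemigroup G S"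
  shows "x \<in> carrier G"
proof -
  interpret group G by fact
  show ?thesis using assms(3) by induction (use assms(2) in auto)
qed

lemma normal_subsemigroup_negative:
  assumes "group G" "l_group L" "h \<in> hom G L" "S \<subseteq> carrier G"
    and neg: "\<And>s. s \<in> S \<Longrightarrow> lle L (h s) \<one>\<^bsub>L\<^esub> \<and> h s \<noteq> \<one>\<^bsub>L\<^esub>"
    and "x \<in> normal_subsemigroup G S"
  shows "lle L (h x) \<one>\<^bsub>L\<^esub> \<and> h x \<noteq> \<one>\<^bsub>L\<^esub>"
proof -
  interpret G: group G by fact
  interpret L: l_group L by fact
  interpret group_hom G L h using assms(3) by unfold_locales
  show ?thesis
    using assms(6)
  proof induction
    case (mult a b)
    then have ab: "a \<in> carrier G" "b \<in> carrier G"
      using normal_subsemigroup_closed[OF assms(1,4)] by blast+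
    have "lle L (h a \<otimes>\<^bsub>L\<^esub> h b) (\<one>\<^bsub>L\<^esub> \<otimes>\<^bsub>L\<^esub> h b)"
      by (rule L.mult_lle_mono) (use ab mult.IH L.lle_refl in auto)
    then have "lle L (h a \<otimes>\<^bsub>L\<^esub> h b) (h b)" using ab by simp
    \<comment> \<open>If the product were the identity, \<open>h b\<close> would lie between the
      identity and itself, against its strictness.\<close>
    then show ?case
      using mult.IH ab L.lle_trans[of "h a \<otimes>\<^bsub>L\<^esub> h b" "h b" "\<one>\<^bsub>L\<^esub>"]
        L.lle_antisym[of "h b" "\<one>\<^bsub>L\<^esub>"] by auto
  next
    case (conj a g)
    then have a: "a \<in> carrier G" using normal_subsemigroup_closed[OF assms(1,4)] by blast
    have "lle L (h g \<otimes>\<^bsub>L\<^esub> h a \<otimes>\<^bsub>L\<^esub> inv\<^bsub>L\<^esub> h g) (h g \<otimes>\<^bsub>L\<^esub> \<one>\<^bsub>L\<^esub> \<otimes>\<^bsub>L\<^esub> inv\<^bsub>L\<^esub> h g)"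
      using a conj by (intro L.translate) auto
    moreover have "h a = \<one>\<^bsub>L\<^esub>" if "h g \<otimes>\<^bsub>L\<^esub> h a \<otimes>\<^bsub>L\<^esub> inv\<^bsub>L\<^esub> h g = \<one>\<^bsub>L\<^esub>"
    proof -
      have "h g \<otimes>\<^bsub>L\<^esub> h a = h g"
        using that a conj.hyps(2) by (simp add: L.inv_solve_right' flip: L.r_one)
      then show ?thesis using a conj.hyps(2) by simp
    qed
    ultimately show ?case using a conj by auto
  qed (rule neg)
qed

lemma ordered_valid_if_one_in_normal_subsemigroup:
  assumes ws: "set ws \<subseteq> carrier (free_group X)"
    and one: "\<one>\<^bsub>rel_free_group \<Sigma> X\<^esub> \<in> normal_subsemigroup (rel_free_group \<Sigma> X) (rel_class \<Sigma> X ` set ws)"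
  shows "ordered_valid TYPE('l) \<Sigma> ws"
  unfolding ordered_valid_def
proof (intro allI impI, rule ccontr)
  fix L :: "'l lgrp" and a
  assume L: "ordered_l_group L" and sat: "satisfies L \<Sigma>" and a: "a \<in> UNIV \<rightarrow> carrier L"
    and neg: "\<not> (\<exists>w \<in> set ws. lle L \<one>\<^bsub>L\<^esub> (word_eval L a w))"
  interpret ordered_l_group L by fact
  have aX: "a \<in> X \<rightarrow> carrier L" using a by blast
  obtain h where h: "h \<in> hom (rel_free_group \<Sigma> X) L"
    "\<And>w. w \<in> carrier (free_group X) \<Longrightarrow> h (rel_class \<Sigma> X w) = word_eval L a w"
    using rel_free_group_hom_words[OF is_group sat aX] by metis
  interpret h: group_hom "rel_free_group \<Sigma> X" L h
    using h(1) group_rel_free_group is_group by (simp add: group_hom_def group_hom_axioms_def)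
  have "lle L (h \<one>\<^bsub>rel_free_group \<Sigma> X\<^esub>) \<one>\<^bsub>L\<^esub> \<and> h \<one>\<^bsub>rel_free_group \<Sigma> X\<^esub> \<noteq> \<one>\<^bsub>L\<^esub>"
  proof (rule normal_subsemigroup_negative[OF group_rel_free_group l_group_axioms h(1) _ _ one])
    show "rel_class \<Sigma> X ` set ws \<subseteq> carrier (rel_free_group \<Sigma> X)"
      using ws by (auto simp: carrier_rel_free_group)
    fix s assume "s \<in> rel_class \<Sigma> X ` set ws"
    then obtain w where w: "w \<in> set ws" "s = rel_class \<Sigma> X w" by blast
    have "word_eval L a w \<in> carrier L"
      using leval_closed[OF l_group_axioms a, of "word_term w"] by (simp add: leval_word_term)
    then show "lle L (h s) \<one>\<^bsub>L\<^esub> \<and> h s \<noteq> \<one>\<^bsub>L\<^esub>"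
      using neg w total[of "word_eval L a w" "\<one>\<^bsub>L\<^esub>"] h(2) ws lle_refl[OF one_closed]
      by (metis one_closed subsetD)
  qed
  then show False by simp
qed

section \<open>Bi-ordered groups as totally ordered l-groups\<close>

definition order_lgrp :: "'a monoid \<Rightarrow> 'a rel \<Rightarrow> 'a lgrp" where
  "order_lgrp G r = \<lparr> carrier = carrier G, mult = mult G, one = \<one>\<^bsub>G\<^esub>,
     lmeet = (\<lambda>x y. if (x, y) \<in> r then x else y), ljoin = (\<lambda>x y. if (x, y) \<in> r then y else x) \<rparr>"

lemma order_lgrp_simps [simp]:
  "carrier (order_lgrp G r) = carrier G"
  "x \<otimes>\<^bsub>order_lgrp G r\<^esub> y = x \<otimes>\<^bsub>G\<^esub> y"
  "\<one>\<^bsub>order_lgrp G r\<^esub> = \<one>\<^bsub>G\<^esub>"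
  "inv\<^bsub>order_lgrp G r\<^esub> x = inv\<^bsub>G\<^esub> x"
  by (simp_all add: order_lgrp_def m_inv_def)

lemma geval_order_lgrp [simp]: "geval (order_lgrp G r) a t = geval G a t"
  by (induction t) simp_all

lemma word_eval_order_lgrp [simp]: "word_eval (order_lgrp G r) a w = word_eval G a w"
  by (induction w) auto

lemma lle_order_lgrp_iff:
  assumes "bi_order G r" "x \<in> carrier G" "y \<in> carrier G"
  shows "lle (order_lgrp G r) x y \<longleftrightarrow> (x, y) \<in> r"
  using assms by (auto simp: lle_def order_lgrp_def bi_order_def partial_bi_order_def
      partial_order_on_def preorder_on_def refl_on_def)

lemma ordered_l_group_order_lgrp:
  assumes "group G" "bi_order G r"
  shows "ordered_l_group (order_lgrp G r)"
proof -
  interpret group G by fact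
  note le = lle_order_lgrp_iff[OF assms(2)]
  have refl: "(x, x) \<in> r" if "x \<in> carrier G" for x
    using assms(2) that by (auto simp: bi_order_def partial_bi_order_def partial_order_on_def
        preorder_on_def refl_on_def)
  have anti: "x = y" if "(x, y) \<in> r" "(y, x) \<in> r" for x y
    using assms(2) that by (auto simp: bi_order_def partial_bi_order_def partial_order_on_def
        antisym_def)
  have trans: "(x, z) \<in> r" if "(x, y) \<in> r" "(y, z) \<in> r" for x y z
    using assms(2) that by (auto simp: bi_order_def partial_bi_order_def partial_order_on_def
        preorder_on_def elim: transE)
  have total: "(x, y) \<in> r \<or> (y, x) \<in> r" if "x \<in> carrier G" "y \<in> carrier G" for x y
    using assms(2) that refl unfolding bi_order_def total_on_def by metis
  have meet: "lmeet (order_lgrp G r) x y = (if (x, y) \<in> r then x else y)"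
    and join: "ljoin (order_lgrp G r) x y = (if (x, y) \<in> r then y else x)" for x y
    by (simp_all add: order_lgrp_def)
  have "group (order_lgrp G r)"
    by (rule groupI) (auto simp: m_assoc intro: l_inv)
  moreover have "l_group_axioms (order_lgrp G r)"
  \<comment> \<open>The cases follow the axioms of \<open>l_group\<close>: closure (1, 2),
    commutativity (3, 4), associativity (5, 6), absorption (7, 8) and translation (9).\<close>
  proof (standard, goal_cases)
    case (9 a b c d)
    then show ?case
      using assms(2) by (simp add: le bi_order_def partial_bi_order_def)
  next
    case (5 x y z)
    then show ?case using total[of x y] total[of y z] trans[of x y z] trans[of z y x] anti
      by (simp add: meet) metis
  next
    case (6 x y z)
    then show ?case using total[of x y] total[of y z] trans[of x y z] trans[of z y x] anti
      by (simp add: join) metis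
  next
    case (3 x y)
    then show ?case using total[of x y] anti[of x y] by (auto simp: meet)
  next
    case (4 x y)
    then show ?case using total[of x y] anti[of x y] by (auto simp: join)
  next
    case (7 x y)
    then show ?case using total[of x y] refl anti[of x y] by (auto simp: meet join)
  next
    case (8 x y)
    then show ?case using total[of x y] refl anti[of x y] by (auto simp: meet join)
  qed (auto simp: meet join)
  moreover have "ordered_l_group_axioms (order_lgrp G r)"
    by standard (simp add: le total)
  ultimately show ?thesis by (simp add: ordered_l_group_def l_group_def)
qed

text \<open>Each closure property of N gives one property of the order. Products give transitivity,
  by (a b^-1)(b c^-1) = a c^-1. Conjugation gives invariance, since (c a d)(c b d)^-1 = c (a b^-1)
  c^-1. Antisymmetry is the absence of the identity: a strictly below b and b strictly below a would
  put a a^-1 into N.\<close>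

lemma partial_bi_order_normal_subsemigroup:
  assumes "group G" "S \<subseteq> carrier G" "\<one>\<^bsub>G\<^esub> \<notin> normal_subsemigroup G S"
  shows "partial_bi_order G {(a, b). a \<in> carrier G \<and> b \<in> carrier G \<and>
     (a = b \<or> a \<otimes>\<^bsub>G\<^esub> inv\<^bsub>G\<^esub> b \<in> normal_subsemigroup G S)}" (is "partial_bi_order G ?r")
proof -
  interpret group G by fact
  let ?N = "normal_subsemigroup G S"
  have comp: "a \<otimes>\<^bsub>G\<^esub> inv\<^bsub>G\<^esub> c \<in> ?N"
    if "a \<in> carrier G" "b \<in> carrier G" "c \<in> carrier G"
      "a \<otimes>\<^bsub>G\<^esub> inv\<^bsub>G\<^esub> b \<in> ?N" "b \<otimes>\<^bsub>G\<^esub> inv\<^bsub>G\<^esub> c \<in> ?N" for a b c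
  proof -
    have "(a \<otimes>\<^bsub>G\<^esub> inv\<^bsub>G\<^esub> b) \<otimes>\<^bsub>G\<^esub> (b \<otimes>\<^bsub>G\<^esub> inv\<^bsub>G\<^esub> c) = a \<otimes>\<^bsub>G\<^esub> inv\<^bsub>G\<^esub> c"
    proof -
      have "inv\<^bsub>G\<^esub> b \<otimes>\<^bsub>G\<^esub> (b \<otimes>\<^bsub>G\<^esub> z) = z" if "z \<in> carrier G" for z
        using that \<open>b \<in> carrier G\<close> by (simp flip: m_assoc)
      then show ?thesis using that(1-3) by (simp add: m_assoc)
    qed
    then show ?thesis using normal_subsemigroup.mult[OF that(4,5)] by simp
  qed
  have "refl_on (carrier G) ?r" by (simp add: refl_on_def)
  moreover have "trans ?r" by (rule transI) (use comp in blast)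
  moreover have "antisym ?r"
  proof (rule antisymI, rule ccontr)
    fix a b assume "(a, b) \<in> ?r" "(b, a) \<in> ?r" "a \<noteq> b"
    then have a: "a \<in> carrier G" and "a \<otimes>\<^bsub>G\<^esub> inv\<^bsub>G\<^esub> a \<in> ?N" using comp[of a b a] by blast+
    then show False using assms(3) r_inv[OF a] by metis
  qed
  moreover have "(c \<otimes>\<^bsub>G\<^esub> a \<otimes>\<^bsub>G\<^esub> d) \<otimes>\<^bsub>G\<^esub> inv\<^bsub>G\<^esub> (c \<otimes>\<^bsub>G\<^esub> b \<otimes>\<^bsub>G\<^esub> d) \<in> ?N"
    if "a \<in> carrier G" "b \<in> carrier G" "c \<in> carrier G" "d \<in> carrier G" "a \<otimes>\<^bsub>G\<^esub> inv\<^bsub>G\<^esub> b \<in> ?N" for a b c d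
  proof -
    have "d \<otimes>\<^bsub>G\<^esub> (inv\<^bsub>G\<^esub> d \<otimes>\<^bsub>G\<^esub> z) = z" if "z \<in> carrier G" for z
      using that \<open>d \<in> carrier G\<close> by (simp flip: m_assoc)
    then have "(c \<otimes>\<^bsub>G\<^esub> a \<otimes>\<^bsub>G\<^esub> d) \<otimes>\<^bsub>G\<^esub> inv\<^bsub>G\<^esub> (c \<otimes>\<^bsub>G\<^esub> b \<otimes>\<^bsub>G\<^esub> d) =
        c \<otimes>\<^bsub>G\<^esub> (a \<otimes>\<^bsub>G\<^esub> inv\<^bsub>G\<^esub> b) \<otimes>\<^bsub>G\<^esub> inv\<^bsub>G\<^esub> c"
      using that(1-4) by (simp add: m_assoc inv_mult_group)
    then show ?thesis using normal_subsemigroup.conj[OF that(5,3)] by simp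
  qed
  ultimately show ?thesis
    unfolding partial_bi_order_def partial_order_on_def preorder_on_def by auto
qed

lemma one_in_normal_subsemigroup_if_ordered_valid:
  fixes X :: "'x set"
  assumes full: "fully_bi_orderable (rel_free_group \<Sigma> X)"
    and ws: "set ws \<subseteq> carrier (free_group X)"
    and valid: "ordered_valid TYPE('x word set) \<Sigma> ws"
  shows "\<one>\<^bsub>rel_free_group \<Sigma> X\<^esub> \<in> normal_subsemigroup (rel_free_group \<Sigma> X) (rel_class \<Sigma> X ` set ws)"
proof (rule ccontr)
  let ?G = "rel_free_group \<Sigma> X" and ?c = "rel_class \<Sigma> X"
  assume one: "\<not> ?thesis"
  interpret group ?G by (rule group_rel_free_group)
  have S: "?c ` set ws \<subseteq> carrier ?G" using ws by (auto simp: carrier_rel_free_group)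
  obtain r where r: "bi_order ?G r"
    and sub: "\<And>a b. \<lbrakk>a \<in> carrier ?G; b \<in> carrier ?G;
      a \<otimes>\<^bsub>?G\<^esub> inv\<^bsub>?G\<^esub> b \<in> normal_subsemigroup ?G (?c ` set ws)\<rbrakk> \<Longrightarrow> (a, b) \<in> r"
  proof -
    obtain r where "bi_order ?G r" "{(a, b). a \<in> carrier ?G \<and> b \<in> carrier ?G \<and>
        (a = b \<or> a \<otimes>\<^bsub>?G\<^esub> inv\<^bsub>?G\<^esub> b \<in> normal_subsemigroup ?G (?c ` set ws))} \<subseteq> r"
      using full partial_bi_order_normal_subsemigroup[OF is_group S one]
      unfolding fully_bi_orderable_def by meson
    then show thesis by (intro that[of r]) blast+
  qed
  let ?L = "order_lgrp ?G r"
  \<comment> \<open>Assignments are total, so variables outside \<open>X\<close> need some value in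
    the carrier; the words in \<open>ws\<close> do not contain them.\<close>
  define a where "a x = (if x \<in> X then ?c [(x, True)] else \<one>\<^bsub>?G\<^esub>)" for x
  have a: "a \<in> UNIV \<rightarrow> carrier ?L"
  proof
    fix x
    have "?c [(x, True)] \<in> carrier ?G" if "x \<in> X"
      unfolding carrier_rel_free_group using generator_in_free_group[OF that] by (rule imageI)
    then show "a x \<in> carrier ?L" by (simp add: a_def)
  qed
  have "ordered_l_group ?L" using is_group r by (rule ordered_l_group_order_lgrp)
  moreover have "satisfies ?L \<Sigma>"
    using rel_free_group_satisfies by (simp add: satisfies_def)
  ultimately have "\<exists>w \<in> set ws. lle ?L \<one>\<^bsub>?L\<^esub> (word_eval ?L a w)"
    using valid a unfolding ordered_valid_def by blast
  then obtain w where w: "w \<in> set ws" "lle ?L \<one>\<^bsub>?G\<^esub> (word_eval ?G a w)" by auto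
  have "?c w = word_eval ?G a w"
    by (rule hom_free_group_eq_word_eval[OF is_group rel_class_hom]) (use w ws in \<open>auto simp: a_def\<close>)
  moreover have c: "?c w \<in> carrier ?G" using S w(1) by blast
  ultimately have "(\<one>\<^bsub>?G\<^esub>, ?c w) \<in> r" using w(2) lle_order_lgrp_iff[OF r one_closed c] by simp
  moreover have w': "?c w \<in> normal_subsemigroup ?G (?c ` set ws)"
    using w(1) by (intro normal_subsemigroup.base) blast
  then have "(?c w, \<one>\<^bsub>?G\<^esub>) \<in> r" using sub[OF c one_closed] c by simp
  \<comment> \<open>The bi-order yields only weak inequalities. Together they force equality, which
    would put the identity into the normal subsemigroup.\<close>
  ultimately have "?c w = \<one>\<^bsub>?G\<^esub>"
    using r by (auto simp: bi_order_def partial_bi_order_def partial_order_on_def antisym_def)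
  then show False using one w' by simp
qed

section \<open>Normal forms of terms\<close>

text \<open>\<open>x\<close> is the meet over \<open>A\<close> in \<open>c\<close> of the joins over \<open>w\<close> in \<open>A\<close>; in a
  total order the joins and the meet are attained.\<close>

definition nf_value :: "('a, 'm) lgrp_scheme \<Rightarrow> ('x \<Rightarrow> 'a) \<Rightarrow> 'x word list list \<Rightarrow> 'a \<Rightarrow> bool" where
  "nf_value L a c x \<longleftrightarrow> (\<forall>A \<in> set c. \<exists>w \<in> set A. lle L x (word_eval L a w)) \<and>
     (\<exists>A \<in> set c. \<forall>w \<in> set A. lle L (word_eval L a w) x)"

lemma set_product_nf:
  "set (product_nf c d) = {concat (map (\<lambda>u. map (\<lambda>v. u @ v) B) A) | A B. A \<in> set c \<and> B \<in> set d}"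
  by (auto simp: product_nf_def)

lemma set_join_nf: "set (join_nf c d) = {A @ B | A B. A \<in> set c \<and> B \<in> set d}"
  by (auto simp: join_nf_def)

context ordered_l_group
begin

context
  fixes a :: "'x \<Rightarrow> 'a"
  assumes a: "a \<in> UNIV \<rightarrow> carrier L"
begin

lemma word_eval_closed: "word_eval L a w \<in> carrier L"
  using leval_closed[OF l_group_axioms a, of "word_term w"] by (simp add: leval_word_term)

lemma word_eval_append: "word_eval L a (u @ v) = word_eval L a u \<otimes> word_eval L a v"
  using a word_eval_closed by (induction u) (auto simp: m_assoc Pi_iff)

text \<open>Multiplication is monotone in both arguments. Hence words above \<open>x\<close> and
  above \<open>y\<close> concatenate to a word above the product, and the lists whose joins attain
  the two minima combine to a list attaining the new minimum.\<close>

lemma nf_value_product: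
  assumes c: "nf_value L a c x" "x \<in> carrier L" and d: "nf_value L a d y" "y \<in> carrier L"
  shows "nf_value L a (product_nf c d) (x \<otimes> y)"
  unfolding nf_value_def
proof (intro conjI ballI)
  fix C assume "C \<in> set (product_nf c d)"
  then obtain A B where C: "C = concat (map (\<lambda>u. map (\<lambda>v. u @ v) B) A)" "A \<in> set c" "B \<in> set d"
    by (auto simp: set_product_nf)
  then obtain u v where "u \<in> set A" "v \<in> set B" "lle L x (word_eval L a u)" "lle L y (word_eval L a v)"
    using c(1) d(1) unfolding nf_value_def by blast
  then show "\<exists>w \<in> set C. lle L (x \<otimes> y) (word_eval L a w)"
    using c(2) d(2) by (intro bexI[of _ "u @ v"])
      (auto simp: C word_eval_append intro!: mult_lle_mono word_eval_closed)
next
  obtain A B where A: "A \<in> set c" "\<And>u. u \<in> set A \<Longrightarrow> lle L (word_eval L a u) x"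
    and B: "B \<in> set d" "\<And>v. v \<in> set B \<Longrightarrow> lle L (word_eval L a v) y"
    using c(1) d(1) unfolding nf_value_def by blast
  have "\<forall>w \<in> set (concat (map (\<lambda>u. map (\<lambda>v. u @ v) B) A)). lle L (word_eval L a w) (x \<otimes> y)"
    using A(2) B(2) c(2) d(2) by (auto simp: word_eval_append intro!: mult_lle_mono word_eval_closed)
  moreover have "concat (map (\<lambda>u. map (\<lambda>v. u @ v) B) A) \<in> set (product_nf c d)"
    using A(1) B(1) by (auto simp: set_product_nf)
  ultimately show "\<exists>C \<in> set (product_nf c d). \<forall>w \<in> set C. lle L (word_eval L a w) (x \<otimes> y)"
    by blast
qed

lemma nf_value_join:
  assumes c: "nf_value L a c x" "x \<in> carrier L" and d: "nf_value L a d y" "y \<in> carrier L"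
  shows "nf_value L a (join_nf c d) (ljoin L x y)"
  unfolding nf_value_def
proof (intro conjI ballI)
  fix C assume "C \<in> set (join_nf c d)"
  then obtain A B where C: "C = A @ B" "A \<in> set c" "B \<in> set d"
    by (auto simp: set_join_nf)
  then obtain u v where "u \<in> set C" "v \<in> set C" "lle L x (word_eval L a u)" "lle L y (word_eval L a v)"
    using c(1) d(1) unfolding nf_value_def by fastforce
  then show "\<exists>w \<in> set C. lle L (ljoin L x y) (word_eval L a w)"
    by (metis join_cases[OF c(2) d(2)])
next
  obtain A B where A: "A \<in> set c" "\<And>u. u \<in> set A \<Longrightarrow> lle L (word_eval L a u) x"
    and B: "B \<in> set d" "\<And>v. v \<in> set B \<Longrightarrow> lle L (word_eval L a v) y"
    using c(1) d(1) unfolding nf_value_def by blast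
  have "\<forall>w \<in> set (A @ B). lle L (word_eval L a w) (ljoin L x y)"
    using A(2) B(2) c(2) d(2) by (auto simp: lle_join_iff word_eval_closed)
  moreover have "A @ B \<in> set (join_nf c d)"
    using A(1) B(1) by (auto simp: set_join_nf)
  ultimately show "\<exists>C \<in> set (join_nf c d). \<forall>w \<in> set C. lle L (word_eval L a w) (ljoin L x y)"
    by blast
qed

lemma nf_value_meet:
  assumes c: "nf_value L a c x" "x \<in> carrier L" and d: "nf_value L a d y" "y \<in> carrier L"
  shows "nf_value L a (c @ d) (lmeet L x y)"
proof (cases rule: meet_cases[OF c(2) d(2)])
  case 1
  have "\<exists>w \<in> set B. lle L x (word_eval L a w)" if "B \<in> set d" for B
    using that d c(2) 1(2) lle_trans word_eval_closed unfolding nf_value_def by metis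
  then show ?thesis using c(1) by (auto simp: 1(1) nf_value_def)
next
  case 2
  have "\<exists>w \<in> set A. lle L y (word_eval L a w)" if "A \<in> set c" for A
    using that c d(2) 2(2) lle_trans word_eval_closed unfolding nf_value_def by metis
  then show ?thesis using d(1) by (auto simp: 2(1) nf_value_def)
qed

text \<open>The induction has to treat a term and its inverse together: \<open>LInv\<close> swaps
  the two components, and the de Morgan laws \<open>inv_join\<close> and \<open>inv_meet\<close>
  exchange meets and joins in the second one.\<close>

lemma nf_value_nf:
  "nf_value L a (fst (nf t)) (leval L a t) \<and> nf_value L a (snd (nf t)) (inv (leval L a t))"
proof (induction t)
  case (LVar x)
  then show ?case using a by (auto simp: nf_value_def lle_refl Pi_iff)
next
  case LOne
  then show ?case by (simp add: nf_value_def lle_refl)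
qed (simp_all add: leval_closed[OF l_group_axioms a] nf_value_product nf_value_meet nf_value_join
    inv_mult_group inv_join inv_meet)

lemma one_lle_leval_iff:
  "lle L \<one> (leval L a t) \<longleftrightarrow> (\<forall>A \<in> set (fst (nf t)). \<exists>w \<in> set A. lle L \<one> (word_eval L a w))"
proof -
  note cl = leval_closed[OF l_group_axioms a, of t]
  have nf: "nf_value L a (fst (nf t)) (leval L a t)" using nf_value_nf by blast
  show ?thesis
  proof (intro iffI ballI)
    fix A assume "lle L \<one> (leval L a t)" "A \<in> set (fst (nf t))"
    then show "\<exists>w \<in> set A. lle L \<one> (word_eval L a w)"
      using nf lle_trans[OF one_closed cl word_eval_closed] unfolding nf_value_def by blast
  next
    assume "\<forall>A \<in> set (fst (nf t)). \<exists>w \<in> set A. lle L \<one> (word_eval L a w)"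
    then show "lle L \<one> (leval L a t)"
      using nf lle_trans[OF one_closed word_eval_closed cl] unfolding nf_value_def by blast
  qed
qed

lemma leval_eq_iff:
  "leval L a s = leval L a t \<longleftrightarrow>
     (\<forall>A \<in> set (fst (nf (LMult (LInv s) t)) @ fst (nf (LMult (LInv t) s))).
        \<exists>w \<in> set A. lle L \<one> (word_eval L a w))"
proof -
  note cl = leval_closed[OF l_group_axioms a]
  have "leval L a s = leval L a t \<longleftrightarrow> lle L (leval L a s) (leval L a t) \<and> lle L (leval L a t) (leval L a s)"
    using lle_antisym lle_refl cl by metis
  also have "\<dots> \<longleftrightarrow> lle L \<one> (leval L a (LMult (LInv s) t)) \<and> lle L \<one> (leval L a (LMult (LInv t) s))"
    by (simp add: one_lle_inv_mult_iff cl)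
  finally show ?thesis unfolding one_lle_leval_iff set_append ball_Un .
qed

end

end

text \<open>The normal forms depend neither on the ordered group nor on the assignment. So the
  quantifier over the lists \<open>A\<close> can be moved in front of those over \<open>L\<close>
  and \<open>a\<close>, which leaves one independent inequality for each list.\<close>

lemma Rep_eq_iff_ordered_valid:
  "Rep_eq TYPE('l) \<Sigma> s t \<longleftrightarrow>
     list_all (ordered_valid TYPE('l) \<Sigma>) (fst (nf (LMult (LInv s) t)) @ fst (nf (LMult (LInv t) s)))"
proof -
  let ?c = "fst (nf (LMult (LInv s) t)) @ fst (nf (LMult (LInv t) s))"
  have "Rep_eq TYPE('l) \<Sigma> s t \<longleftrightarrow> (\<forall>(L :: 'l lgrp) a. ordered_l_group L \<longrightarrow> satisfies L \<Sigma> \<longrightarrow>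
      a \<in> UNIV \<rightarrow> carrier L \<longrightarrow> (\<forall>A \<in> set ?c. \<exists>w \<in> set A. lle L \<one>\<^bsub>L\<^esub> (word_eval L a w)))"
    unfolding Rep_eq_iff_ordered
    by (intro iff_allI imp_cong refl) (rule ordered_l_group.leval_eq_iff)
  then show ?thesis unfolding list_all_iff ordered_valid_def by blast
qed

section \<open>The two decision problems and their reductions to each other\<close>

lemma normal_identity_problem_iff:
  assumes "fully_bi_orderable (rel_free_group \<Sigma> (UNIV :: nat set))"
  shows "normal_identity_problem \<Sigma> ws \<longleftrightarrow> ordered_valid TYPE(nat word set) \<Sigma> ws"
proof -
  have sub: "set (map reduce ws) \<subseteq> carrier (free_group UNIV)" by (auto simp: free_group_def)
  have "normal_identity_problem \<Sigma> ws \<longleftrightarrow>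
      \<one>\<^bsub>rel_free_group \<Sigma> UNIV\<^esub> \<in> normal_subsemigroup (rel_free_group \<Sigma> UNIV)
        (rel_class \<Sigma> UNIV ` set (map reduce ws))"
    by (simp add: normal_identity_problem_def image_image)
  also have "\<dots> \<longleftrightarrow> ordered_valid TYPE(nat word set) \<Sigma> (map reduce ws)"
    using ordered_valid_if_one_in_normal_subsemigroup[OF sub]
      one_in_normal_subsemigroup_if_ordered_valid[OF assms sub] by blast
  also have "\<dots> \<longleftrightarrow> ordered_valid TYPE(nat word set) \<Sigma> ws"
    by (simp add: ordered_valid_def word_eval_reduce ordered_l_group_def l_group_def)
  finally show ?thesis .
qed

lemma normal_identity_problem_decidable_iff:
  "normal_identity_problem_decidable \<Sigma> \<longleftrightarrow> computable (normal_identity_problem \<Sigma>)"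
proof -
  have word: "word_code = enc" by (simp add: fun_eq_iff enc_nat_word)
  have "(\<lambda>ws. list_encode (map word_code ws)) = enc"
    unfolding word by (rule ext) (rule enc_list_def[symmetric])
  then show ?thesis
    by (simp add: normal_identity_problem_decidable_def decidable_via_iff)
qed

lemma equational_theory_decidable_iff:
  "equational_theory_decidable TYPE('l) \<Sigma> \<longleftrightarrow>
     computable (\<lambda>p :: nat lterm \<times> nat lterm. Rep_eq TYPE('l) \<Sigma> (fst p) (snd p))"
proof -
  have code: "(\<lambda>(s, t). prod_encode (lterm_code s, lterm_code t)) = enc"
    by (simp add: fun_eq_iff enc_nat_lterm)
  show ?thesis
    unfolding equational_theory_decidable_def code decidable_via_iff unfolding case_prod_unfold ..
qed

theorem corollary13:
  fixes \<Sigma> :: group_eqs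
  assumes "infinite (UNIV :: 'l set)"
  shows
    "(\<forall>(X :: 'x set) ts.
        fully_bi_orderable (rel_free_group \<Sigma> X) \<and> ts \<noteq> [] \<and> set ts \<subseteq> carrier (free_group X) \<longrightarrow>
        (\<one>\<^bsub>rel_free_group \<Sigma> X\<^esub> \<in>
            normal_subsemigroup (rel_free_group \<Sigma> X) (rel_class \<Sigma> X ` set ts) \<longleftrightarrow>
         Rep_le TYPE('l) \<Sigma> LOne (big_join (map word_term ts))))
     \<and> (fully_bi_orderable (rel_free_group \<Sigma> (UNIV :: nat set)) \<longrightarrow>
        (normal_identity_problem_decidable \<Sigma> \<longleftrightarrow> equational_theory_decidable TYPE('l) \<Sigma>))"
proof (intro conjI allI impI, elim conjE)
  fix X :: "'x set" and ts
  assume full: "fully_bi_orderable (rel_free_group \<Sigma> X)" and ne: "ts \<noteq> []"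
    and ts: "set ts \<subseteq> carrier (free_group X)"
  show "\<one>\<^bsub>rel_free_group \<Sigma> X\<^esub> \<in>
      normal_subsemigroup (rel_free_group \<Sigma> X) (rel_class \<Sigma> X ` set ts) \<longleftrightarrow>
    Rep_le TYPE('l) \<Sigma> LOne (big_join (map word_term ts))"
  proof
    assume "\<one>\<^bsub>rel_free_group \<Sigma> X\<^esub> \<in>
      normal_subsemigroup (rel_free_group \<Sigma> X) (rel_class \<Sigma> X ` set ts)"
    then show "Rep_le TYPE('l) \<Sigma> LOne (big_join (map word_term ts))"
      unfolding Rep_le_big_join_iff[OF ne] by (rule ordered_valid_if_one_in_normal_subsemigroup[OF ts])
  next
    assume "Rep_le TYPE('l) \<Sigma> LOne (big_join (map word_term ts))"
    \<comment> \<open>The bi-order will be put on the relatively free group itself, whose elements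
      have this type; infinity of \<open>'l\<close> allows the passage to any carrier type.\<close>
    then have "Rep_le TYPE('x word set) \<Sigma> LOne (big_join (map word_term ts))"
      unfolding Rep_le_def by (rule Rep_eq_all_types[OF assms])
    then show "\<one>\<^bsub>rel_free_group \<Sigma> X\<^esub> \<in>
        normal_subsemigroup (rel_free_group \<Sigma> X) (rel_class \<Sigma> X ` set ts)"
      unfolding Rep_le_big_join_iff[OF ne]
      by (rule one_in_normal_subsemigroup_if_ordered_valid[OF full ts])
  qed
next
  assume full: "fully_bi_orderable (rel_free_group \<Sigma> (UNIV :: nat set))"
  let ?N = "normal_identity_problem \<Sigma>"
  let ?E = "\<lambda>s t :: nat lterm. Rep_eq TYPE('l) \<Sigma> s t"
  have "infinite (UNIV :: nat word set set)"
    by (simp add: Finite_Set.finite_set infinite_UNIV_listI)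
  then have E: "?E s t \<longleftrightarrow> Rep_eq TYPE(nat word set) \<Sigma> s t" for s t
    using assms by (intro Rep_eq_types)
  have N: "ordered_valid TYPE(nat word set) \<Sigma> = ?N"
    using normal_identity_problem_iff[OF full] by blast
  have EN: "?E s t \<longleftrightarrow> list_all ?N (fst (nf (LMult (LInv s) t)) @ fst (nf (LMult (LInv t) s)))" for s t
    unfolding E unfolding Rep_eq_iff_ordered_valid N ..
  \<comment> \<open>The empty instance is answered separately: nothing generates the empty normal
    subsemigroup's elements, and \<open>big_join\<close> has no meaning there.\<close>
  have NE: "?N ws \<longleftrightarrow> (case ws of [] \<Rightarrow> False
      | v # vs \<Rightarrow> ?E (LMeet LOne (big_join (map word_term (v # vs)))) LOne)" for ws
  proof (cases ws)
    case Nil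
    have "False" if "x \<in> normal_subsemigroup G {}" for x and G :: "nat word set monoid"
      using that by induction simp_all
    then show ?thesis by (auto simp: Nil normal_identity_problem_def)
  next
    case (Cons v vs)
    have "Rep_le TYPE(nat word set) \<Sigma> LOne (big_join (map word_term (v # vs))) \<longleftrightarrow> ?N (v # vs)"
      unfolding N[symmetric] by (rule Rep_le_big_join_iff) simp
    then show ?thesis by (simp only: Cons list.case E Rep_le_def)
  qed
  show "normal_identity_problem_decidable \<Sigma> \<longleftrightarrow> equational_theory_decidable TYPE('l) \<Sigma>"
    unfolding normal_identity_problem_decidable_iff equational_theory_decidable_iff
  proof
    assume "computable ?N"
    note [computable_intros] = computable_comp[OF this] computable_comp[OF computable_nf]
    have "computable (\<lambda>p. list_all (\<lambda>A. ?N A) (fst (nf (LMult (LInv (fst p)) (snd p))) @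
        fst (nf (LMult (LInv (snd p)) (fst p)))))"
      by (intro computable_intros)
    then show "computable (\<lambda>p. ?E (fst p) (snd p))" by (simp only: EN)
  next
    assume "computable (\<lambda>p. ?E (fst p) (snd p))"
    from computable_comp[OF this, of "\<lambda>p. (LMeet LOne (big_join (map word_term (fst p # snd p))), LOne)"]
    have "computable (\<lambda>p. ?E (LMeet LOne (big_join (map word_term (fst p # snd p)))) LOne)"
      by (simp add: computable_intros computable_big_join_Cons del: list.map)
    \<comment> \<open>The rule for list cases supplies head, tail and the whole list as a nested
      triple, so the function of head and tail is precomposed with the projection to these
      two.\<close>
    from computable_comp[OF this, of "\<lambda>p. (fst p, fst (snd p))"]
    have "computable (\<lambda>p :: nat word \<times> nat word list \<times> nat word list.
        ?E (LMeet LOne (big_join (map word_term (fst p # fst (snd p))))) LOne)"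
      by (simp add: computable_intros del: list.map)
    then have "computable (\<lambda>ws. case ws of [] \<Rightarrow> False
        | v # vs \<Rightarrow> ?E (LMeet LOne (big_join (map word_term (v # vs)))) LOne)"
      by (intro computable_case_list computable_intros)
    then show "computable ?N" unfolding NE[abs_def] .
  qed
qed

end
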